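(* Let $S=k[x_{1,0},\ldots,x_{1,n_1},\ldots,x_{m,0},\ldots,x_{m,n_m}]$ and for $i=1,\ldots,m$ let $S^{[i]}=k[x_{i,0},\ldots,x_{i,n_i}]$ with $n_i\ge1$, and $T^{[i]}=k[X_{i,0},\ldots,X_{i,n_i}]$. Let $F = F_1+ \cdots + F_m \in S_d$ with $F_i \in S^{[i]}_d$. Let $e\ge1$ be an integer. If every $F_i$, regarded as a form in $S^{[i]}$, is $e$-computable and satisfies $(F_i^\perp)_e=0$ (with $F_i^\perp\subseteq T^{[i]}$), then \[ \mathrm{rk}(F) = \mathrm{rk} (F_1 )+ \cdots + \mathrm{rk} (F_m ).\]
   Context: $k$ is algebraically closed of characteristic zero. $T^{[i]}$ acts on $S^{[i]}$ by differentiation ($X_{i,j}\circ G=\partial G/\partial x_{i,j}$); $F_i^\perp=\{g\in T^{[i]}: g\circ F_i=0\}$. $HF(R/J,j)=\dim_kR_j-\dim_kJ_j$. The rank $\mathrm{rk}(G)$ of a form $G$ of degree $d$ is the least $r$ with $G=\sum_{j=1}^rL_j^d$, $L_j$ linear forms (this does not depend on the polynomial ring in which $G$ is considered). A form $G\in S^{[i]}$ is $e$-computable if there is a homogeneous ideal $I\subset T^{[i]}$ generated in degree $e$ such that for a general $t\in I_e$ (i.e. $t$ in a nonempty Zariski-open subset of $I_e$) $\mathrm{rk}(G)=\frac1e\sum_{j=0}^\infty HF(T^{[i]}/((G^\perp:I)+(t)),j)$. *)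

theory Defs
  imports Complex_Main "HOL-Library.Poly_Mapping"
begin

text \<open>A monomial is a finitely supported exponent vector 'v \<Rightarrow>0 nat; a polynomial
  is a finitely supported map from monomials to coefficients.  Both the rings
  S^[i] = k[x_(i,j)] and the dual rings T^[i] = k[X_(i,j)] are represented as
  polynomials whose monomials only involve variables from a given finite set V
  of variable indices (the variable X_(i,j) of T^[i] corresponds to x_(i,j)).\<close>

type_synonym ('v, 'k) mpoly = "('v \<Rightarrow>\<^sub>0 nat) \<Rightarrow>\<^sub>0 'k"

definition mvar :: "'v \<Rightarrow> ('v, 'k::{zero,one}) mpoly" where
  "mvar v = Poly_Mapping.single (Poly_Mapping.single v 1) 1"

definition mdeg :: "('v \<Rightarrow>\<^sub>0 nat) \<Rightarrow> nat" where
  "mdeg \<alpha> = (\<Sum>v\<in>Poly_Mapping.keys \<alpha>. Poly_Mapping.lookup \<alpha> v)"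

definition polyring :: "'v set \<Rightarrow> ('v, 'k::zero) mpoly set" where
  "polyring V = {p. \<forall>\<alpha>\<in>Poly_Mapping.keys p. Poly_Mapping.keys \<alpha> \<subseteq> V}"

text \<open>Forms of degree d (the zero polynomial is a form of every degree).\<close>
definition homog :: "nat \<Rightarrow> ('v, 'k::zero) mpoly \<Rightarrow> bool" where
  "homog d p \<longleftrightarrow> (\<forall>\<alpha>\<in>Poly_Mapping.keys p. mdeg \<alpha> = d)"

definition graded_part :: "nat \<Rightarrow> ('v, 'k::zero) mpoly set \<Rightarrow> ('v, 'k) mpoly set" where
  "graded_part d J = {p \<in> J. homog d p}"

definition linear_form :: "'v set \<Rightarrow> ('v, 'k::comm_ring_1) mpoly \<Rightarrow> bool" where
  "linear_form V L \<longleftrightarrow> L \<in> polyring V \<and> homog 1 L"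

definition wrank :: "'v set \<Rightarrow> nat \<Rightarrow> ('v, 'k::comm_ring_1) mpoly \<Rightarrow> nat" where
  "wrank V d G = (LEAST r. \<exists>L :: nat \<Rightarrow> ('v, 'k) mpoly.
      (\<forall>j<r. linear_form V (L j)) \<and> G = (\<Sum>j<r. L j ^ d))"

text \<open>Action of the monomial X^beta on x^alpha by differentiation:
  X^beta o x^alpha = (prod_v alpha_v!/(alpha_v-beta_v)!) x^(alpha-beta) if beta \<le> alpha,
  and 0 otherwise; extended bilinearly.\<close>
definition mle :: "('v \<Rightarrow>\<^sub>0 nat) \<Rightarrow> ('v \<Rightarrow>\<^sub>0 nat) \<Rightarrow> bool" where
  "mle \<beta> \<alpha> \<longleftrightarrow> (\<forall>v. Poly_Mapping.lookup \<beta> v \<le> Poly_Mapping.lookup \<alpha> v)"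

definition diff_coeff :: "('v \<Rightarrow>\<^sub>0 nat) \<Rightarrow> ('v \<Rightarrow>\<^sub>0 nat) \<Rightarrow> nat" where
  "diff_coeff \<beta> \<alpha> = (\<Prod>v\<in>Poly_Mapping.keys \<beta>. fact (Poly_Mapping.lookup \<alpha> v) div fact (Poly_Mapping.lookup \<alpha> v - Poly_Mapping.lookup \<beta> v))"

definition apolar :: "('v, 'k::comm_ring_1) mpoly \<Rightarrow> ('v, 'k) mpoly \<Rightarrow> ('v, 'k) mpoly" where
  "apolar g G = (\<Sum>\<beta>\<in>Poly_Mapping.keys g. \<Sum>\<alpha>\<in>Poly_Mapping.keys G.
      if mle \<beta> \<alpha>
      then Poly_Mapping.single (\<alpha> - \<beta>) (of_nat (diff_coeff \<beta> \<alpha>) * Poly_Mapping.lookup g \<beta> * Poly_Mapping.lookup G \<alpha>)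
      else 0)"

definition perp :: "'v set \<Rightarrow> ('v, 'k::comm_ring_1) mpoly \<Rightarrow> ('v, 'k) mpoly set" where
  "perp V F = {g \<in> polyring V. apolar g F = 0}"

definition ideal_gen :: "'v set \<Rightarrow> ('v, 'k::comm_ring_1) mpoly set \<Rightarrow> ('v, 'k) mpoly set" where
  "ideal_gen V A = {p. \<exists>n (c :: nat \<Rightarrow> ('v, 'k) mpoly) (a :: nat \<Rightarrow> ('v, 'k) mpoly).
      (\<forall>j<n. c j \<in> polyring V \<and> a j \<in> A) \<and> p = (\<Sum>j<n. c j * a j)}"

definition colon :: "'v set \<Rightarrow> ('v, 'k::comm_ring_1) mpoly set \<Rightarrow> ('v, 'k) mpoly set \<Rightarrow> ('v, 'k) mpoly set" where
  "colon V J I = {g \<in> polyring V. \<forall>h\<in>I. g * h \<in> J}"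

definition ideal_plus_principal :: "'v set \<Rightarrow> ('v, 'k::comm_ring_1) mpoly set \<Rightarrow> ('v, 'k) mpoly \<Rightarrow> ('v, 'k) mpoly set" where
  "ideal_plus_principal V J t = {a + b * t | a b. a \<in> J \<and> b \<in> polyring V}"

definition kscale :: "'k::comm_ring_1 \<Rightarrow> ('v, 'k) mpoly \<Rightarrow> ('v, 'k) mpoly" where
  "kscale c p = Poly_Mapping.map (\<lambda>x. c * x) p"

definition kdim :: "('v, 'k::field) mpoly set \<Rightarrow> nat" where
  "kdim W = vector_space.dim kscale W"

definition hilbert_fun :: "'v set \<Rightarrow> ('v, 'k::field) mpoly set \<Rightarrow> nat \<Rightarrow> nat" where
  "hilbert_fun V J j = kdim (graded_part j (polyring V :: ('v, 'k) mpoly set)) - kdim (graded_part j J)"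

text \<open>Polynomial functions of the coefficients: a polynomial P whose variables are
  indexed by monomials, evaluated at the coefficient vector of t.\<close>
definition coeff_eval :: "(('v \<Rightarrow>\<^sub>0 nat), 'k::comm_ring_1) mpoly \<Rightarrow> ('v, 'k) mpoly \<Rightarrow> 'k" where
  "coeff_eval P t = (\<Sum>\<gamma>\<in>Poly_Mapping.keys P. Poly_Mapping.lookup P \<gamma> * (\<Prod>\<mu>\<in>Poly_Mapping.keys \<gamma>. Poly_Mapping.lookup t \<mu> ^ Poly_Mapping.lookup \<gamma> \<mu>))"

definition zariski_open_in :: "('v, 'k::comm_ring_1) mpoly set \<Rightarrow> ('v, 'k) mpoly set \<Rightarrow> bool" where
  "zariski_open_in W U \<longleftrightarrow> (\<exists>Ps. U = {t \<in> W. \<exists>P\<in>Ps. coeff_eval P t \<noteq> 0})"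

definition e_computable :: "'v set \<Rightarrow> nat \<Rightarrow> nat \<Rightarrow> ('v, 'k::field) mpoly \<Rightarrow> bool" where
  "e_computable V d e G \<longleftrightarrow>
     (\<exists>A. A \<subseteq> graded_part e (polyring V) \<and>
        (let I = ideal_gen V A in
         \<exists>U. zariski_open_in (graded_part e I) U \<and> U \<noteq> {} \<and>
           (\<forall>t\<in>U. summable (\<lambda>j. real (hilbert_fun V
                         (ideal_plus_principal V (colon V (perp V G) I) t) j)) \<and>
              real (wrank V d G) = (1 / real e) * suminf (\<lambda>j. real (hilbert_fun V
                         (ideal_plus_principal V (colon V (perp V G) I) t) j)))))"

definition alg_closed_type :: "'k::field itself \<Rightarrow> bool" where
  "alg_closed_type _ \<longleftrightarrow> (\<forall>(n::nat) (c::nat \<Rightarrow> 'k). n \<ge> 1 \<longrightarrow> c n \<noteq> 0 \<longrightarrow>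
       (\<exists>x. (\<Sum>i\<le>n. c i * x ^ i) = 0))"

end

(*
  Let F = L_1^d + ... + L_s^d and let a_l be the coefficient vector of L_l.  Choose t_i general in
  (I_i)_e and let t be a general combination of the t_i, so that t is nonzero at every a_l at which
  some t_i is.  Let J be the ideal of these points X, so that h(j) = dim (T/J)_j is at most
  s and multiplication by t is injective on T/J.  Setting the variables outside the i-th
  block to zero maps J into B_i = (F_i^perp : I_i) and t to a multiple of t_i; if K is the set of
  polynomials that are mapped into B_i + (t_i) for all i, then
    sum_i HF(T^[i] / (B_i + (t_i)), j) <= dim (T/K)_j <= h(j) - h(j - e)   for j >= 1.
  In degree 0 the left-hand side may exceed its bound by m - 1.  This is compensated in degree e:
  K contains all of t_1, ..., t_m there, and they are independent modulo J because a
  combination of them lying in J annihilates F, whereas (F_i^perp)_e = 0.  The sum over j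
  telescopes, which gives e (rk F_1 + ... + rk F_m) <= e s.
*)
theory Submission
  imports Defs "HOL-Computational_Algebra.Polynomial"
begin

text \<open>The colon by I_i is what makes it harmless to keep only the points in X: where all t_i
  vanish, the general choice of t_i forces every generator of I_i to vanish too, so a generator
  makes up for a condition that g in J does not satisfy. Nothing is asked of the points themselves;
  they may be zero or proportional, since only the upper bound h(j) <= s and the nonvanishing of t
  on X enter. Degree 0 is exceptional because the constants of T are common to all blocks, whereas
  forms of positive degree in different blocks are independent. In degree e, multiplication by t
  alone would give at most one dimension of K modulo J, where m are required. The independence that
  supplies them rests on e < d, which is not assumed: it follows from (F_i^perp)_e = 0 because every
  block has at least two variables. It puts the derivatives of the F_i in positive degree d - e, so
  that they cannot cancel across blocks. Algebraic closedness ensures that every form is a sum of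
  powers of linear forms, so that the minimum defining the rank exists.\<close>

text \<open>The map Q -> K/J induced by \<open>f\<close> has kernel inside M, so dim Q - dim M <=
  dim K - dim J; the additive form avoids truncated subtraction. It is applied to the identity, to
  evaluation at a point and to multiplication by a form.\<close>

lemma (in vector_space) dim_add_le_via_linear:
  assumes sub: "subspace J" "subspace M" "subspace K"
    and f: "Vector_Spaces.linear scale scale f"
    and incl: "M \<subseteq> Q" "J \<subseteq> K" "f ` Q \<subseteq> K"
    and ker: "\<And>q. q \<in> Q \<Longrightarrow> f q \<in> J \<Longrightarrow> q \<in> M"
    and fin: "finite A" "subspace Q" "Q \<subseteq> span A" "finite B" "K \<subseteq> span B"
  shows "dim J + dim Q \<le> dim K + dim M"
proof -
  interpret f: Vector_Spaces.linear scale scale f by (rule f)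
  obtain BM where BM: "BM \<subseteq> M" "independent BM" "M \<subseteq> span BM"
    using maximal_independent_subset by blast
  obtain BQ where BQ: "BM \<subseteq> BQ" "BQ \<subseteq> Q" "independent BQ" "Q \<subseteq> span BQ"
    using maximal_independent_subset_extend[of BM Q] BM incl by blast
  obtain BJ where BJ: "BJ \<subseteq> J" "independent BJ" "J \<subseteq> span BJ"
    using maximal_independent_subset by blast
  have fQ: "finite BQ" using independent_span_bound[OF fin(1) BQ(3)] BQ fin by blast
  have fJ: "finite BJ" using independent_span_bound[OF fin(4) BJ(2)] BJ fin incl by blast
  have spJ: "span BJ = J" using BJ sub span_minimal by blast
  have spM: "span BM = M" using BM sub span_minimal by blast
  define N where "N = BQ - BM"
  have fN: "finite N" using fQ N_def by simp
  have "independent (f ` N' \<union> BJ) \<and> card (f ` N' \<union> BJ) = card N' + card BJ" if "N' \<subseteq> N" for N'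
  proof -
    have "finite N'" using fN that finite_subset by blast
    then show ?thesis using that
    proof (induction N' rule: finite_induct)
      case empty then show ?case using BJ by simp
    next
      case (insert x N')
      \<comment> \<open>A relation f x = f y + v with v in J puts x - y into M, the span of
        \<open>BM\<close>, and this contradicts the independence of \<open>BQ\<close>.\<close>
      have notin: "f x \<notin> span (f ` N' \<union> BJ)"
      proof
        assume "f x \<in> span (f ` N' \<union> BJ)"
        then obtain u v where uv: "u \<in> span (f ` N')" "v \<in> span BJ" "f x = u + v"
          by (auto simp: span_Un)
        then obtain y where y: "y \<in> span N'" "u = f y"
          using f.span_image[of N'] by auto
        have "f (x - y) \<in> J" using uv y spJ by (simp add: f.diff)
        moreover have yQ: "y \<in> Q" using y insert.prems BQ span_minimal[OF _ fin(2), of N'] N_def by blast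
        moreover have "x \<in> Q" using insert.prems BQ N_def by blast
        ultimately have "x - y \<in> span BM" using ker[of "x - y"] spM fin(2) subspace_diff by blast
        moreover have "span BM \<subseteq> span (BQ - {x})" using insert.prems BQ N_def by (intro span_mono) auto
        moreover have "span N' \<subseteq> span (BQ - {x})" using insert.hyps insert.prems BQ N_def by (intro span_mono) auto
        ultimately have "(x - y) + y \<in> span (BQ - {x})" using y span_add by blast
        then have "x \<in> span (BQ - {x})" by simp
        moreover have "x \<in> BQ" using insert.prems N_def by blast
        ultimately show False using BQ(3) dependent_def by blast
      qed
      then have "f x \<notin> f ` N' \<union> BJ" using span_superset[of "f ` N' \<union> BJ"] by (meson subsetD)
      then show ?case using insert notin fJ independent_insertI[OF notin] by simp
    qed
  qed
  then have ind: "independent (f ` N \<union> BJ)" "card (f ` N \<union> BJ) = card N + card BJ" by auto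
  have sK: "f ` N \<union> BJ \<subseteq> K" using incl BQ BJ N_def by blast
  have "card (f ` N \<union> BJ) \<le> dim K"
  proof -
    obtain C where C: "f ` N \<union> BJ \<subseteq> C" "C \<subseteq> K" "independent C" "K \<subseteq> span C"
      using maximal_independent_subset_extend[OF sK ind(1)] by blast
    have "finite C" using independent_span_bound[OF fin(4) C(3)] C fin by blast
    then have "card (f ` N \<union> BJ) \<le> card C" using C card_mono by blast
    also have "card C = dim K" using C basis_card_eq_dim by blast
    finally show ?thesis .
  qed
  moreover have "card BQ = dim Q" "card BM = dim M" "card BJ = dim J"
    using BQ BM BJ basis_card_eq_dim by blast+
  moreover have "card N = card BQ - card BM" "card BM \<le> card BQ"
    using BQ fQ N_def by (auto simp: card_Diff_subset finite_subset card_mono)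
  ultimately show ?thesis using ind by linarith
qed

section \<open>Polynomials as a vector space over the coefficient field\<close>

abbreviation lookup where "lookup \<equiv> Poly_Mapping.lookup"
abbreviation keys where "keys \<equiv> Poly_Mapping.keys"
abbreviation single where "single \<equiv> Poly_Mapping.single"

lemma lookup_kscale [simp]: "lookup (kscale c p) \<alpha> = c * lookup p \<alpha>"
  by (simp add: kscale_def map.rep_eq when_def)

text \<open>The whole type is infinite-dimensional; each dimension count below therefore comes with
  a finite spanning set of a graded piece.\<close>

interpretation mp: vector_space "kscale :: 'k::field \<Rightarrow> ('v, 'k) mpoly \<Rightarrow> _"
  by unfold_locales (auto intro!: poly_mapping_eqI simp: lookup_add algebra_simps)

lemma kdim_eq: "kdim = mp.dim"
  by (simp add: kdim_def fun_eq_iff)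

lemma kscale_conv_mult: "kscale c p = single 0 c * p"
  by (simp add: kscale_def mult_map_scale_conv_mult)

lemma kscale_mult_left: "kscale c p * q = kscale c (p * q)"
  and kscale_mult_right: "p * kscale c q = kscale c (p * q)"
  by (simp_all add: kscale_conv_mult algebra_simps)

lemma sum_monomials: "(\<Sum>\<alpha>\<in>keys p. single \<alpha> (lookup p \<alpha>)) = p"
proof (rule poly_mapping_eqI)
  fix \<beta>
  have "lookup (\<Sum>\<alpha>\<in>keys p. single \<alpha> (lookup p \<alpha>)) \<beta> = (\<Sum>\<alpha>\<in>keys p. if \<alpha> = \<beta> then lookup p \<alpha> else 0)"
    by (simp add: lookup_sum lookup_single when_def)
  also have "\<dots> = lookup p \<beta>" by (simp add: in_keys_iff)
  finally show "lookup (\<Sum>\<alpha>\<in>keys p. single \<alpha> (lookup p \<alpha>)) \<beta> = lookup p \<beta>" .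
qed

text \<open>Nested in several arguments, this reduces multilinear identities to single
  terms.\<close>

lemma poly_induct [case_names zero add single]:
  fixes p :: "'a \<Rightarrow>\<^sub>0 'b::comm_monoid_add"
  assumes "P 0" "\<And>p q. P p \<Longrightarrow> P q \<Longrightarrow> P (p + q)" "\<And>\<alpha> c. P (single \<alpha> c)"
  shows "P p"
proof -
  have "P (\<Sum>\<alpha>\<in>A. single \<alpha> (lookup p \<alpha>))" if "finite A" for A
    using that by induction (auto intro: assms)
  from this[of "keys p"] show ?thesis by (simp add: sum_monomials)
qed

subsection \<open>Monomials\<close>

lemma keys_add_nat: "keys ((\<alpha> :: 'v \<Rightarrow>\<^sub>0 nat) + \<beta>) = keys \<alpha> \<union> keys \<beta>"
  by (auto simp: in_keys_iff lookup_add)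

text \<open>Over a common finite index set additivity becomes distributivity of the sum. The same
  device recurs for evaluation, apolarity and \<open>diff_coeff\<close>.\<close>

lemma mdeg_superset: "finite A \<Longrightarrow> keys \<alpha> \<subseteq> A \<Longrightarrow> mdeg \<alpha> = (\<Sum>v\<in>A. lookup \<alpha> v)"
  unfolding mdeg_def by (rule sum.mono_neutral_left) (auto simp: in_keys_iff)

lemma mdeg_add: "mdeg (\<alpha> + \<beta>) = mdeg \<alpha> + mdeg \<beta>"
proof -
  have "mdeg \<gamma> = (\<Sum>v\<in>keys \<alpha> \<union> keys \<beta>. lookup \<gamma> v)" if "\<gamma> \<in> {\<alpha>, \<beta>, \<alpha> + \<beta>}" for \<gamma>
    using that by (intro mdeg_superset) (auto simp: keys_add_nat)
  then show ?thesis by (simp add: lookup_add sum.distrib)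
qed

lemma mdeg_0 [simp]: "mdeg 0 = 0"
  by (simp add: mdeg_def)

lemma mdeg_single [simp]: "mdeg (single v n) = n"
  by (simp add: mdeg_def)

lemma mdeg_eq_0_iff [simp]: "mdeg \<alpha> = 0 \<longleftrightarrow> \<alpha> = 0"
  by (auto simp: mdeg_def in_keys_iff intro!: poly_mapping_eqI)

lemma mle_iff_add: "mle \<beta> \<alpha> \<longleftrightarrow> (\<exists>\<gamma>. \<alpha> = \<beta> + \<gamma>)"
proof
  assume "mle \<beta> \<alpha>"
  then have "\<alpha> = \<beta> + (\<alpha> - \<beta>)"
    by (auto intro!: poly_mapping_eqI simp: mle_def lookup_add lookup_minus)
  then show "\<exists>\<gamma>. \<alpha> = \<beta> + \<gamma>" by blast
qed (auto simp: mle_def lookup_add)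

lemma monomial_split: 
  assumes "lookup \<alpha> v > 0"
  shows "\<alpha> = single v (1::nat) + (\<alpha> - single v 1)"
  using assms by (auto intro!: poly_mapping_eqI simp: lookup_add lookup_minus lookup_single when_def)

lemma monomial_induct [case_names zero add]:
  fixes \<alpha> :: "'v \<Rightarrow>\<^sub>0 nat"
  assumes "P 0" "\<And>v \<alpha>. P \<alpha> \<Longrightarrow> P (single v 1 + \<alpha>)"
  shows "P \<alpha>"
proof (induction "mdeg \<alpha>" arbitrary: \<alpha>)
  case 0 then show ?case using assms by simp
next
  case (Suc n)
  then have "\<alpha> \<noteq> 0" by (metis mdeg_0 nat.distinct(1))
  then obtain v where "lookup \<alpha> v > 0" by (metis gr0I lookup_zero poly_mapping_eqI)
  note e = monomial_split[OF this]
  have "mdeg \<alpha> = 1 + mdeg (\<alpha> - single v 1)" by (subst e) (simp add: mdeg_add)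
  then show ?case using Suc assms(2) e by (metis Suc_eq_plus1_left Suc_inject)
qed

lemma mdeg_eq_1D:
  assumes "mdeg \<alpha> = 1" obtains v where "\<alpha> = single v 1"
  using assms
proof (induction \<alpha> rule: monomial_induct)
  case zero then show ?case by simp
next
  case (add v \<alpha>) then show ?case by (simp add: mdeg_add)
qed

subsection \<open>Graded pieces\<close>

lemma polyring_single: "single \<alpha> c \<in> polyring V \<longleftrightarrow> c = 0 \<or> keys \<alpha> \<subseteq> V"
  by (auto simp: polyring_def)

lemma polyring_0 [simp]: "0 \<in> polyring V" by (simp add: polyring_def)

lemma polyring_1 [simp]: "(1 :: ('v, 'k::comm_ring_1) mpoly) \<in> polyring V" by (simp add: polyring_def)

lemma polyring_add: "p \<in> polyring V \<Longrightarrow> q \<in> polyring V \<Longrightarrow> p + q \<in> polyring V"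
  using keys_add[of p q] by (fastforce simp: polyring_def)

lemma polyring_mult: "p \<in> polyring V \<Longrightarrow> q \<in> polyring V \<Longrightarrow> p * q \<in> polyring V"
  using keys_mult[of p q] by (fastforce simp: polyring_def keys_add_nat)

lemma keys_kscale: "keys (kscale c p) \<subseteq> keys p"
  by (auto simp: in_keys_iff)

lemma polyring_kscale: "p \<in> polyring V \<Longrightarrow> kscale c p \<in> polyring V"
  using keys_kscale[of c p] by (fastforce simp: polyring_def)

lemma polyring_sum: "(\<And>i. i \<in> A \<Longrightarrow> f i \<in> polyring V) \<Longrightarrow> sum f A \<in> polyring V"
  by (induction A rule: infinite_finite_induct) (auto intro: polyring_add)

lemma polyring_mono: "V \<subseteq> W \<Longrightarrow> polyring V \<subseteq> polyring W"
  by (auto simp: polyring_def)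

lemma homog_0 [simp]: "homog d 0" by (simp add: homog_def)

lemma homog_single: "homog d (single \<alpha> c) \<longleftrightarrow> c = 0 \<or> mdeg \<alpha> = d"
  by (auto simp: homog_def)

lemma homog_add: "homog d p \<Longrightarrow> homog d q \<Longrightarrow> homog d (p + q)"
  using keys_add[of p q] by (fastforce simp: homog_def)

lemma homog_kscale: "homog d p \<Longrightarrow> homog d (kscale c p)"
  using keys_kscale[of c p] by (fastforce simp: homog_def)

lemma homog_mult: "homog d p \<Longrightarrow> homog e q \<Longrightarrow> homog (d + e) (p * q)"
  using keys_mult[of p q] by (fastforce simp: homog_def mdeg_add)

lemma homog_sum: "(\<And>i. i \<in> A \<Longrightarrow> homog d (f i)) \<Longrightarrow> homog d (sum f A)"
  by (induction A rule: infinite_finite_induct) (auto intro: homog_add)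

lemma subspace_polyring: "mp.subspace (polyring V)"
  by (auto simp: mp.subspace_def polyring_add polyring_kscale)

lemma subspace_graded_part: "mp.subspace J \<Longrightarrow> mp.subspace (graded_part j J)"
  by (auto simp: mp.subspace_def graded_part_def homog_add homog_kscale)

lemma single_kscale: "single \<alpha> c = kscale c (single \<alpha> 1)"
  by (auto intro!: poly_mapping_eqI simp: lookup_single when_def)

lemma graded_part_finite_span:
  assumes "finite V"
  obtains B :: "('v, 'k::field) mpoly set"
  where "finite B" "graded_part j (polyring V) \<subseteq> mp.span B"
proof -
  define E where "E = {\<alpha> :: 'v \<Rightarrow>\<^sub>0 nat. keys \<alpha> \<subseteq> V \<and> mdeg \<alpha> = j}"
  \<comment> \<open>No exponent of a monomial of degree j exceeds j, which leaves finitely many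
    exponent functions.\<close>
  have "lookup ` E \<subseteq> {f. (\<forall>v\<in>V. f v \<in> {..j}) \<and> (\<forall>v. v \<notin> V \<longrightarrow> f v = 0)}"
  proof
    fix f assume "f \<in> lookup ` E"
    then obtain \<alpha> where a: "f = lookup \<alpha>" "keys \<alpha> \<subseteq> V" "mdeg \<alpha> = j" by (auto simp: E_def)
    have "lookup \<alpha> v \<le> j" if "v \<in> V" for v
      using member_le_sum[of v V "lookup \<alpha>"] mdeg_superset[OF assms a(2)] a assms that by simp
    then show "f \<in> {f. (\<forall>v\<in>V. f v \<in> {..j}) \<and> (\<forall>v. v \<notin> V \<longrightarrow> f v = 0)}"
      using a by (auto simp: in_keys_iff)
  qed
  moreover have "finite {f :: 'v \<Rightarrow> nat. (\<forall>v\<in>V. f v \<in> {..j}) \<and> (\<forall>v. v \<notin> V \<longrightarrow> f v = 0)}"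
    using finite_set_of_finite_funs[OF assms, of "{..j}" 0] by (rule rev_finite_subset) auto
  ultimately have "finite (lookup ` E)" by (rule finite_subset)
  then have "finite E" by (rule finite_imageD) (simp add: inj_on_def lookup_inject)
  moreover have "graded_part j (polyring V) \<subseteq> mp.span ((\<lambda>\<alpha>. single \<alpha> (1::'k)) ` E)"
  proof
    fix p :: "('v, 'k) mpoly" assume p: "p \<in> graded_part j (polyring V)"
    have "(\<Sum>\<alpha>\<in>keys p. single \<alpha> (lookup p \<alpha>)) \<in> mp.span ((\<lambda>\<alpha>. single \<alpha> (1::'k)) ` E)"
    proof (rule mp.span_sum)
      fix \<alpha> assume "\<alpha> \<in> keys p"
      then have "\<alpha> \<in> E" using p by (auto simp: graded_part_def polyring_def homog_def E_def)
      then show "single \<alpha> (lookup p \<alpha>) \<in> mp.span ((\<lambda>\<alpha>. single \<alpha> (1::'k)) ` E)"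
        by (subst single_kscale) (intro mp.span_scale mp.span_base imageI)
    qed
    then show "p \<in> mp.span ((\<lambda>\<alpha>. single \<alpha> (1::'k)) ` E)" by (simp add: sum_monomials)
  qed
  ultimately show thesis using that by blast
qed

subsection \<open>Evaluation at a point\<close>

definition mon_eval :: "('v \<Rightarrow> 'k::comm_ring_1) \<Rightarrow> ('v \<Rightarrow>\<^sub>0 nat) \<Rightarrow> 'k" where
  "mon_eval a \<alpha> = (\<Prod>v\<in>keys \<alpha>. a v ^ lookup \<alpha> v)"

definition poly_eval :: "('v \<Rightarrow> 'k::comm_ring_1) \<Rightarrow> ('v, 'k) mpoly \<Rightarrow> 'k" where
  "poly_eval a p = (\<Sum>\<alpha>\<in>keys p. lookup p \<alpha> * mon_eval a \<alpha>)"

text \<open>Here the variables are themselves monomials and the point is the coefficient vector of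
  t, so Zariski-open conditions fall under the same evaluation map.\<close>

lemma coeff_eval_eq_poly_eval: "coeff_eval P t = poly_eval (lookup t) P"
  by (simp add: coeff_eval_def poly_eval_def mon_eval_def)

lemma mon_eval_superset: "finite A \<Longrightarrow> keys \<alpha> \<subseteq> A \<Longrightarrow> mon_eval a \<alpha> = (\<Prod>v\<in>A. a v ^ lookup \<alpha> v)"
  unfolding mon_eval_def by (rule prod.mono_neutral_left) (auto simp: in_keys_iff)

lemma mon_eval_add: "mon_eval a (\<alpha> + \<beta>) = mon_eval a \<alpha> * mon_eval a \<beta>"
proof -
  have "mon_eval a \<gamma> = (\<Prod>v\<in>keys \<alpha> \<union> keys \<beta>. a v ^ lookup \<gamma> v)" if "\<gamma> \<in> {\<alpha>, \<beta>, \<alpha> + \<beta>}" for \<gamma>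
    using that by (intro mon_eval_superset) (auto simp: keys_add_nat)
  then show ?thesis by (simp add: lookup_add power_add prod.distrib)
qed

lemma mon_eval_0 [simp]: "mon_eval a 0 = 1"
  by (simp add: mon_eval_def)

lemma mon_eval_single [simp]: "mon_eval a (single v n) = a v ^ n"
  by (cases "n = 0") (simp_all add: mon_eval_def)

lemma poly_eval_superset: "finite A \<Longrightarrow> keys p \<subseteq> A \<Longrightarrow> poly_eval a p = (\<Sum>\<alpha>\<in>A. lookup p \<alpha> * mon_eval a \<alpha>)"
  unfolding poly_eval_def by (rule sum.mono_neutral_left) (auto simp: in_keys_iff)

lemma poly_eval_single [simp]: "poly_eval a (single \<alpha> c) = c * mon_eval a \<alpha>"
  by (cases "c = 0") (auto simp: poly_eval_def)

lemma poly_eval_0 [simp]: "poly_eval a 0 = 0"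
  by (simp add: poly_eval_def)

lemma poly_eval_add: "poly_eval a (p + q) = poly_eval a p + poly_eval a q"
proof -
  have "poly_eval a r = (\<Sum>\<alpha>\<in>keys p \<union> keys q. lookup r \<alpha> * mon_eval a \<alpha>)" if "r \<in> {p, q, p + q}" for r
    using that keys_add[of p q] by (intro poly_eval_superset) auto
  then show ?thesis by (simp add: lookup_add distrib_right sum.distrib)
qed

lemma poly_eval_mult: "poly_eval a (p * q) = poly_eval a p * poly_eval a q"
proof (induction p rule: poly_induct)
  case (single \<alpha> c)
  show ?case
    by (induction q rule: poly_induct)
      (simp_all add: mult_single mon_eval_add poly_eval_add algebra_simps)
qed (simp_all add: poly_eval_add algebra_simps)

lemma poly_eval_kscale: "poly_eval a (kscale c p) = c * poly_eval a p"
  by (simp add: kscale_conv_mult poly_eval_mult)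

lemma poly_eval_sum: "poly_eval a (sum f A) = (\<Sum>i\<in>A. poly_eval a (f i))"
  by (induction A rule: infinite_finite_induct) (simp_all add: poly_eval_add)

subsection \<open>Discarding variables\<close>

text \<open>This is the substitution of 0 for the variables outside V, a ring retraction onto
  \<open>polyring V\<close>, encoded by dropping monomials.\<close>

definition restrict_vars :: "'v set \<Rightarrow> ('v, 'k::zero) mpoly \<Rightarrow> ('v, 'k) mpoly" where
  "restrict_vars V p = Poly_Mapping.mapp (\<lambda>\<alpha> c. if keys \<alpha> \<subseteq> V then c else 0) p"

lemma lookup_restrict_vars: "lookup (restrict_vars V p) \<alpha> = (if keys \<alpha> \<subseteq> V then lookup p \<alpha> else 0)"
  by (auto simp: restrict_vars_def lookup_mapp in_keys_iff when_def)

lemma keys_restrict_vars: "keys (restrict_vars V p) = {\<alpha> \<in> keys p. keys \<alpha> \<subseteq> V}"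
  unfolding set_eq_iff mem_Collect_eq in_keys_iff[of _ p] in_keys_iff[of _ "restrict_vars V p"]
  by (simp add: lookup_restrict_vars)

lemma restrict_vars_add: "restrict_vars V (p + q) = restrict_vars V p + restrict_vars V q"
  by (auto intro!: poly_mapping_eqI simp: lookup_restrict_vars lookup_add)

lemma restrict_vars_0 [simp]: "restrict_vars V 0 = 0"
  by (auto intro!: poly_mapping_eqI simp: lookup_restrict_vars)

lemma restrict_vars_kscale: "restrict_vars V (kscale c p) = kscale c (restrict_vars V p)"
  by (auto intro!: poly_mapping_eqI simp: lookup_restrict_vars)

lemma restrict_vars_sum: "restrict_vars V (sum f A) = (\<Sum>i\<in>A. restrict_vars V (f i))"
  by (induction A rule: infinite_finite_induct) (simp_all add: restrict_vars_add)

lemma restrict_vars_single: "restrict_vars V (single \<alpha> c) = (if keys \<alpha> \<subseteq> V then single \<alpha> c else 0)"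
  by (rule poly_mapping_eqI) (simp add: lookup_restrict_vars lookup_single when_def)

lemma restrict_vars_mult:
  "restrict_vars V (p * q) = restrict_vars V p * restrict_vars V (q :: ('v, 'k::comm_ring_1) mpoly)"
proof (induction p rule: poly_induct)
  case (single \<alpha> c)
  show ?case
    by (induction q rule: poly_induct)
      (simp_all add: mult_single restrict_vars_single keys_add_nat restrict_vars_add algebra_simps)
qed (simp_all add: restrict_vars_add algebra_simps)

lemma restrict_vars_id: "p \<in> polyring V \<Longrightarrow> restrict_vars V p = p"
  by (rule poly_mapping_eqI)
    (metis (mono_tags, lifting) lookup_restrict_vars polyring_def in_keys_iff mem_Collect_eq)

lemma restrict_vars_in_polyring: "restrict_vars V p \<in> polyring V"
  by (auto simp: polyring_def keys_restrict_vars)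

lemma keys_eq_empty_nat: "keys (\<alpha> :: 'v \<Rightarrow>\<^sub>0 'b::zero) = {} \<longleftrightarrow> \<alpha> = 0"
  by (metis keys_zero lookup_not_eq_zero_eq_in_keys empty_iff lookup_zero poly_mapping_eqI)

text \<open>The only monomial common to both rings is 1, and positive degree excludes it. The
  failure for constants is why degree 0 needs separate treatment later.\<close>

lemma restrict_vars_disjoint:
  assumes "p \<in> polyring W" "V \<inter> W = {}" "homog d p" "d \<ge> 1"
  shows "restrict_vars V p = 0"
proof -
  have False if "\<alpha> \<in> keys (restrict_vars V p)" for \<alpha>
  proof -
    have "\<alpha> \<in> keys p" "keys \<alpha> \<subseteq> V" using that by (simp_all add: keys_restrict_vars)
    then have "keys \<alpha> \<subseteq> V \<inter> W" "mdeg \<alpha> = d"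
      using assms(1,3) unfolding polyring_def homog_def by blast+
    then show False using assms(2,4) by (simp add: keys_eq_empty_nat)
  qed
  then show ?thesis by (metis all_not_in_conv keys_eq_empty_nat)
qed

subsection \<open>The apolarity action\<close>

text \<open>One summand of \<open>apolar\<close>. With the coefficients as arguments it is additive
  in each of them and vanishes at 0, so index sets can be enlarged freely.\<close>

definition mon_apolar :: "('v \<Rightarrow>\<^sub>0 nat) \<Rightarrow> 'k \<Rightarrow> ('v \<Rightarrow>\<^sub>0 nat) \<Rightarrow> 'k \<Rightarrow> ('v, 'k::comm_ring_1) mpoly" where
  "mon_apolar \<beta> b \<alpha> a = (if mle \<beta> \<alpha> then single (\<alpha> - \<beta>) (of_nat (diff_coeff \<beta> \<alpha>) * b * a) else 0)"

lemma mon_apolar_add_left: "mon_apolar \<beta> (b + b') \<alpha> a = mon_apolar \<beta> b \<alpha> a + mon_apolar \<beta> b' \<alpha> a"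
  and mon_apolar_add_right: "mon_apolar \<beta> b \<alpha> (a + a') = mon_apolar \<beta> b \<alpha> a + mon_apolar \<beta> b \<alpha> a'"
  by (simp_all add: mon_apolar_def single_add[symmetric] algebra_simps)

lemma mon_apolar_0 [simp]: "mon_apolar \<beta> 0 \<alpha> a = 0" "mon_apolar \<beta> b \<alpha> 0 = 0"
  by (simp_all add: mon_apolar_def)

lemma apolar_superset:
  assumes "finite A" "keys g \<subseteq> A" "finite B" "keys G \<subseteq> B"
  shows "apolar g G = (\<Sum>\<beta>\<in>A. \<Sum>\<alpha>\<in>B. mon_apolar \<beta> (lookup g \<beta>) \<alpha> (lookup G \<alpha>))"
proof -
  have "apolar g G = (\<Sum>\<beta>\<in>keys g. \<Sum>\<alpha>\<in>keys G. mon_apolar \<beta> (lookup g \<beta>) \<alpha> (lookup G \<alpha>))"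
    by (simp add: apolar_def mon_apolar_def)
  also have "\<dots> = (\<Sum>\<beta>\<in>keys g. \<Sum>\<alpha>\<in>B. mon_apolar \<beta> (lookup g \<beta>) \<alpha> (lookup G \<alpha>))"
    using assms by (intro sum.cong sum.mono_neutral_left) (auto simp: in_keys_iff)
  also have "\<dots> = (\<Sum>\<beta>\<in>A. \<Sum>\<alpha>\<in>B. mon_apolar \<beta> (lookup g \<beta>) \<alpha> (lookup G \<alpha>))"
    using assms by (intro sum.mono_neutral_left) (auto simp: in_keys_iff)
  finally show ?thesis .
qed

lemma apolar_add_left: "apolar (f + g) G = apolar f G + apolar g G"
proof -
  have "apolar h G = (\<Sum>\<beta>\<in>keys f \<union> keys g. \<Sum>\<alpha>\<in>keys G. mon_apolar \<beta> (lookup h \<beta>) \<alpha> (lookup G \<alpha>))"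
    if "h \<in> {f, g, f + g}" for h
    using that keys_add[of f g] by (intro apolar_superset) auto
  then show ?thesis by (simp add: lookup_add mon_apolar_add_left sum.distrib)
qed

lemma apolar_add_right: "apolar g (F + G) = apolar g F + apolar g G"
proof -
  have "apolar g H = (\<Sum>\<beta>\<in>keys g. \<Sum>\<alpha>\<in>keys F \<union> keys G. mon_apolar \<beta> (lookup g \<beta>) \<alpha> (lookup H \<alpha>))"
    if "H \<in> {F, G, F + G}" for H
    using that keys_add[of F G] by (intro apolar_superset) auto
  then show ?thesis by (simp add: lookup_add mon_apolar_add_right sum.distrib)
qed

lemma apolar_0_left [simp]: "apolar 0 G = 0"
  and apolar_0_right [simp]: "apolar g 0 = 0"
  by (simp_all add: apolar_def)

lemma apolar_sum_left: "apolar (sum f A) G = (\<Sum>i\<in>A. apolar (f i) G)"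
  by (induction A rule: infinite_finite_induct) (simp_all add: apolar_add_left)

lemma apolar_sum_right: "apolar g (sum f A) = (\<Sum>i\<in>A. apolar g (f i))"
  by (induction A rule: infinite_finite_induct) (simp_all add: apolar_add_right)

lemma apolar_single: "apolar (single \<beta> b) (single \<alpha> a) = mon_apolar \<beta> b \<alpha> a"
proof -
  have "apolar (single \<beta> b) (single \<alpha> a) = (\<Sum>\<beta>'\<in>{\<beta>}. \<Sum>\<alpha>'\<in>{\<alpha>}. mon_apolar \<beta>' (lookup (single \<beta> b) \<beta>') \<alpha>' (lookup (single \<alpha> a) \<alpha>'))"
    by (rule apolar_superset) (auto split: if_splits)
  then show ?thesis by simp
qed

lemma diff_coeff_superset:
  assumes "finite A" "keys \<beta> \<subseteq> A"
  shows "diff_coeff \<beta> \<alpha> = (\<Prod>v\<in>A. fact (lookup \<alpha> v) div fact (lookup \<alpha> v - lookup \<beta> v))"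
  unfolding diff_coeff_def using assms
  by (intro prod.mono_neutral_left) (auto simp: in_keys_iff)

text \<open>In each variable (b+c+d)!/d! splits at (b+d)!, and all the divisions are exact. The
  cofactor \<open>\<delta>\<close> replaces truncated differences of exponents.\<close>

lemma diff_coeff_add:
  "diff_coeff (\<beta> + \<gamma>) (\<beta> + \<gamma> + \<delta>) = diff_coeff \<beta> (\<beta> + \<delta>) * diff_coeff \<gamma> (\<beta> + \<gamma> + \<delta>)"
proof -
  have *: "fact (b + c + d) div fact d = (fact (b + d) div fact d) * (fact (b + c + d) div fact (b + d) :: nat)" for b c d :: nat
  proof -
    have "(fact d::nat) dvd fact (b + d)" "(fact (b + d)::nat) dvd fact (b + c + d)"
      by (auto intro: fact_dvd)
    then show ?thesis by (auto simp: dvd_def)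
  qed
  have "diff_coeff \<epsilon> \<alpha> = (\<Prod>v\<in>keys \<beta> \<union> keys \<gamma>. fact (lookup \<alpha> v) div fact (lookup \<alpha> v - lookup \<epsilon> v))"
    if "\<epsilon> \<in> {\<beta>, \<gamma>, \<beta> + \<gamma>}" for \<epsilon> \<alpha>
    using that by (intro diff_coeff_superset) (auto simp: keys_add_nat)
  then show ?thesis
    by (simp add: prod.distrib[symmetric] lookup_add *)
qed

lemma mon_apolar_mult:
  "mon_apolar (\<beta> + \<gamma>) (b * c) \<alpha> a = apolar (single \<beta> b) (mon_apolar \<gamma> c \<alpha> a)"
proof (cases "mle (\<beta> + \<gamma>) \<alpha>")
  case True
  then obtain \<delta> where d: "\<alpha> = \<beta> + \<gamma> + \<delta>" by (auto simp: mle_iff_add)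
  have 1: "mle \<gamma> \<alpha>" "mle \<beta> (\<beta> + \<delta>)" unfolding mle_iff_add d by (metis add.assoc add.commute)+
  have 2: "\<alpha> - \<gamma> = \<beta> + \<delta>" "\<alpha> - (\<beta> + \<gamma>) = \<delta>" unfolding d
    by (metis add.assoc add.commute add_diff_cancel_left')+
  show ?thesis using True 1
    by (simp add: mon_apolar_def 2 apolar_single) (simp only: d diff_coeff_add of_nat_mult mult.assoc mult.left_commute)
next
  case False
  have "\<not> (mle \<gamma> \<alpha> \<and> mle \<beta> (\<alpha> - \<gamma>))"
  proof
    assume "mle \<gamma> \<alpha> \<and> mle \<beta> (\<alpha> - \<gamma>)"
    then obtain \<delta> \<delta>' where "\<alpha> = \<gamma> + \<delta>" "\<alpha> - \<gamma> = \<beta> + \<delta>'" by (auto simp: mle_iff_add)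
    then have "\<alpha> = \<beta> + \<gamma> + \<delta>'" by (simp add: add.assoc add.left_commute)
    then show False using False by (auto simp: mle_iff_add)
  qed
  then show ?thesis using False by (auto simp: mon_apolar_def apolar_single)
qed

text \<open>The action makes polynomials a module over the dual ring; this is what makes
  annihilators ideals and lets a product be applied factor by factor.\<close>

lemma apolar_mult: "apolar (f * g) G = apolar f (apolar g G)"
proof (induction G rule: poly_induct)
  case (single \<alpha> a)
  show ?case
  proof (induction g rule: poly_induct)
    case (single \<gamma> c)
    show ?case
      by (induction f rule: poly_induct)
        (simp_all add: mult_single apolar_single mon_apolar_mult apolar_add_left distrib_right)
  qed (simp_all add: apolar_add_left apolar_add_right distrib_left)
qed (simp_all add: apolar_add_right)

lemma apolar_const: "apolar (single 0 c) G = single 0 c * G"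
proof (induction G rule: poly_induct)
  case (single \<alpha> a)
  have "mle 0 \<alpha>" by (simp add: mle_def)
  then show ?case by (simp add: apolar_single mon_apolar_def mult_single diff_coeff_def)
qed (simp_all add: apolar_add_right distrib_left)

lemma apolar_kscale: "apolar (kscale c g) G = kscale c (apolar g G)"
  by (simp add: kscale_conv_mult apolar_mult apolar_const)

lemma mon_apolar_polyring: "keys \<alpha> \<subseteq> V \<Longrightarrow> mon_apolar \<beta> b \<alpha> a \<in> polyring V"
  by (auto simp: mon_apolar_def polyring_single in_keys_iff lookup_minus subset_iff)

lemma apolar_polyring: "G \<in> polyring V \<Longrightarrow> apolar g G \<in> polyring V"
  unfolding apolar_superset[OF finite_keys subset_refl finite_keys subset_refl]
  by (intro polyring_sum mon_apolar_polyring) (auto simp: polyring_def)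

text \<open>For e > d no monomial of g divides one of G, so the result is 0 and the truncated degree
  does no harm. For e \<ge> d the statement says that the result is a constant.\<close>

lemma homog_apolar:
  assumes "homog e g" "homog d G"
  shows "homog (d - e) (apolar g G)"
  unfolding apolar_superset[OF finite_keys subset_refl finite_keys subset_refl]
proof (intro homog_sum)
  fix \<beta> \<alpha> assume "\<beta> \<in> keys g" "\<alpha> \<in> keys G"
  then have "mdeg \<beta> = e" "mdeg \<alpha> = d" using assms by (auto simp: homog_def)
  then show "homog (d - e) (mon_apolar \<beta> (lookup g \<beta>) \<alpha> (lookup G \<alpha>))"
    by (auto simp: mon_apolar_def homog_single mle_iff_add mdeg_add)
qed

text \<open>A monomial containing a variable outside V divides no monomial of G and hence acts as
  0.\<close>

lemma apolar_restrict_vars: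
  assumes "G \<in> polyring V"
  shows "apolar g G = apolar (restrict_vars V g) G"
proof -
  have "apolar (restrict_vars V g) G = (\<Sum>\<beta>\<in>keys g. \<Sum>\<alpha>\<in>keys G. mon_apolar \<beta> (lookup (restrict_vars V g) \<beta>) \<alpha> (lookup G \<alpha>))"
    by (rule apolar_superset) (auto simp: keys_restrict_vars)
  also have "\<dots> = (\<Sum>\<beta>\<in>keys g. \<Sum>\<alpha>\<in>keys G. mon_apolar \<beta> (lookup g \<beta>) \<alpha> (lookup G \<alpha>))"
  proof (intro sum.cong refl)
    fix \<beta> \<alpha> assume "\<alpha> \<in> keys G"
    then have "keys \<alpha> \<subseteq> V" using assms by (auto simp: polyring_def)
    then show "mon_apolar \<beta> (lookup (restrict_vars V g) \<beta>) \<alpha> (lookup G \<alpha>) = mon_apolar \<beta> (lookup g \<beta>) \<alpha> (lookup G \<alpha>)"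
      by (auto simp: lookup_restrict_vars mon_apolar_def mle_iff_add keys_add_nat)
  qed
  also have "\<dots> = apolar g G" by (rule apolar_superset[symmetric]) auto
  finally show ?thesis ..
qed

text \<open>When the exponent of v is 0 the coefficient vanishes, which makes the truncated monomial
  on the right harmless.\<close>

lemma apolar_mvar_single:
  "apolar (single (single v 1) 1) (single \<alpha> a) = single (\<alpha> - single v 1) (of_nat (lookup \<alpha> v) * a)"
proof (cases "lookup \<alpha> v")
  case 0
  then have "\<not> mle (single v 1) \<alpha>" by (auto simp: mle_def lookup_single when_def)
  then show ?thesis using 0 by (simp add: apolar_single mon_apolar_def)
next
  case (Suc n)
  then have "mle (single v 1) \<alpha>" by (auto simp: mle_def lookup_single when_def)
  moreover have "diff_coeff (single v 1) \<alpha> = lookup \<alpha> v"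
    using Suc by (simp add: diff_coeff_def)
  ultimately show ?thesis by (simp add: apolar_single mon_apolar_def)
qed

lemma monomial_add_minus: 
  assumes "lookup \<alpha> v > 0" shows "\<alpha> - single v (1::nat) + \<beta> = \<alpha> + \<beta> - single v 1"
  using assms by (auto intro!: poly_mapping_eqI simp: lookup_add lookup_minus lookup_single when_def)

text \<open>The Leibniz rule for a partial derivative; on monomials it is the additivity of the
  exponent of v.\<close>

lemma apolar_mvar_mult:
  fixes p q :: "('v, 'k::comm_ring_1) mpoly" and v :: 'v
  defines "D \<equiv> single (single v 1) 1"
  shows "apolar D (p * q) = apolar D p * q + p * apolar D q"
proof (induction p rule: poly_induct)
  case (single \<alpha> a)
  show ?case
  proof (induction q rule: poly_induct)
    case (single \<beta> b)
    \<comment> \<open>If v does not occur in \<open>\<alpha>\<close>, both sides have coefficient 0,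
      although the truncated exponents need not agree.\<close>
    have 1: "single (\<alpha> - single v 1) (of_nat (lookup \<alpha> v) * a) * single \<beta> b
        = single (\<alpha> + \<beta> - single v 1) (of_nat (lookup \<alpha> v) * a * b)"
      using monomial_add_minus[of \<alpha> v \<beta>] by (cases "lookup \<alpha> v") (auto simp: mult_single)
    have 2: "single \<alpha> a * single (\<beta> - single v 1) (of_nat (lookup \<beta> v) * b)
        = single (\<alpha> + \<beta> - single v 1) (of_nat (lookup \<beta> v) * a * b)"
      using monomial_add_minus[of \<beta> v \<alpha>] by (cases "lookup \<beta> v") (auto simp: mult_single ac_simps)
    show ?case unfolding D_def apolar_mvar_single 1 2
      unfolding mult_single apolar_mvar_single
      by (simp add: single_add[symmetric] lookup_add algebra_simps)
  qed (simp_all add: apolar_add_right algebra_simps)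
qed (simp_all add: apolar_add_right algebra_simps)

lemma single_one_eq_iff: "single w (1::nat) = single v 1 \<longleftrightarrow> w = v"
  by (metis keys_single one_neq_zero singleton_inject)

lemma apolar_mvar_linear:
  assumes "homog 1 L"
  shows "apolar (single (single v 1) 1) L = single 0 (lookup L (single v 1))"
proof -
  have "apolar (single (single v 1) 1) L = (\<Sum>\<alpha>\<in>keys L. apolar (single (single v 1) 1) (single \<alpha> (lookup L \<alpha>)))"
    by (simp flip: apolar_sum_right add: sum_monomials)
  also have "\<dots> = (\<Sum>\<alpha>\<in>keys L. if \<alpha> = single v 1 then single 0 (lookup L \<alpha>) else 0)"
  proof (intro sum.cong refl)
    fix \<alpha> assume "\<alpha> \<in> keys L"
    then obtain w where w: "\<alpha> = single w 1" using assms mdeg_eq_1D by (auto simp: homog_def) 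
    show "apolar (single (single v 1) 1) (single \<alpha> (lookup L \<alpha>)) = (if \<alpha> = single v 1 then single 0 (lookup L \<alpha>) else 0)"
      unfolding apolar_mvar_single w using single_one_eq_iff[of w v]
      by (auto simp: lookup_single when_def)
  qed
  also have "\<dots> = single 0 (lookup L (single v 1))" by (auto simp: in_keys_iff)
  finally show ?thesis .
qed

lemma apolar_mvar_power:
  assumes "homog 1 L"
  shows "apolar (single (single v 1) 1) (L ^ n) = of_nat n * single 0 (lookup L (single v 1)) * L ^ (n - 1)"
proof (induction n)
  case 0
  show ?case using apolar_mvar_single[of v 0 1] by simp
next
  case (Suc n)
  have "apolar (single (single v 1) 1) (L ^ Suc n) = single 0 (lookup L (single v 1)) * L ^ n
      + L * (of_nat n * single 0 (lookup L (single v 1)) * L ^ (n - 1))"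
    unfolding power_Suc apolar_mvar_mult apolar_mvar_linear[OF assms] Suc.IH by simp
  also have "\<dots> = of_nat (Suc n) * single 0 (lookup L (single v 1)) * L ^ n"
    by (cases n) (simp_all add: algebra_simps)
  finally show ?case by simp
qed

text \<open>The point dual to a linear form: dual forms vanishing here annihilate every power of
  L.\<close>

definition point_of :: "('v, 'k::zero) mpoly \<Rightarrow> 'v \<Rightarrow> 'k" where
  "point_of L v = lookup L (single v 1)"

text \<open>The falling factorial vanishes for e > d, which covers the degrees in which
  the truncated exponent d - e is meaningless.\<close>

lemma apolar_monomial_power:
  fixes L :: "('v, 'k::comm_ring_1) mpoly"
  assumes "homog 1 L"
  shows "apolar (single \<alpha> 1) (L ^ d) =
    of_nat (\<Prod>i<mdeg \<alpha>. d - i) * single 0 (mon_eval (point_of L) \<alpha>) * L ^ (d - mdeg \<alpha>)"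
proof (induction \<alpha> rule: monomial_induct)
  case zero
  show ?case using apolar_const[of 1 "L ^ d"] by simp
next
  case (add v \<alpha>)
  \<comment> \<open>Constants act by multiplication, so they commute past D because the dual ring is
    commutative.\<close>
  have C: "apolar D (of_nat m * single 0 c * p) = of_nat m * single 0 c * apolar D p"
    for D p :: "('v, 'k) mpoly" and c m
  proof -
    have e: "of_nat m * single 0 c = (single 0 (of_nat m * c) :: ('v, 'k) mpoly)"
      by (simp add: mult_single flip: single_of_nat)
    show ?thesis unfolding e
      by (metis apolar_const apolar_mult mult.commute)
  qed
  have "apolar (single (single v 1 + \<alpha>) 1) (L ^ d) = apolar (single (single v 1) 1) (apolar (single \<alpha> 1) (L ^ d))"
    by (simp add: mult_single flip: apolar_mult)
  also have "\<dots> = of_nat (\<Prod>i<mdeg \<alpha>. d - i) * single 0 (mon_eval (point_of L) \<alpha>)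
      * (of_nat (d - mdeg \<alpha>) * single 0 (point_of L v) * L ^ (d - mdeg \<alpha> - 1))"
    unfolding add.IH C apolar_mvar_power[OF assms] by (simp add: point_of_def)
  also have "\<dots> = (of_nat (\<Prod>i<mdeg \<alpha>. d - i) * of_nat (d - mdeg \<alpha>))
      * (single 0 (mon_eval (point_of L) \<alpha>) * single 0 (point_of L v)) * L ^ (d - mdeg \<alpha> - 1)"
    by (simp only: mult.assoc mult.left_commute)
  also have "\<dots> = of_nat (\<Prod>i<mdeg (single v 1 + \<alpha>). d - i) * single 0 (mon_eval (point_of L) (single v 1 + \<alpha>))
      * L ^ (d - mdeg (single v 1 + \<alpha>))"
    by (simp add: mult_single mon_eval_add mdeg_add mult.commute)
  finally show ?case .
qed

text \<open>All monomials of g have degree e and so produce the same falling factorial and the same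
  power of L; what remains adds up to the value of g at the point of L. This translates vanishing at
  points into annihilation of power sums.\<close>

lemma apolar_power:
  fixes g :: "('v, 'k::comm_ring_1) mpoly"
  assumes "homog 1 L" "homog e g"
  shows "apolar g (L ^ d) =
    of_nat (\<Prod>i<e. d - i) * single 0 (poly_eval (point_of L) g) * L ^ (d - e)"
proof -
  have s: "apolar (single \<alpha> c) G = single 0 c * apolar (single \<alpha> 1) G" for \<alpha> c and G :: "('v, 'k) mpoly"
    by (metis single_kscale apolar_kscale kscale_conv_mult)
  have s0: "single 0 (sum f A) = (\<Sum>x\<in>A. single (0 :: 'v \<Rightarrow>\<^sub>0 nat) (f x :: 'k))" for f and A :: "('v \<Rightarrow>\<^sub>0 nat) set"
    by (induction A rule: infinite_finite_induct) (simp_all add: single_add)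
  have "apolar g (L ^ d) = (\<Sum>\<alpha>\<in>keys g. apolar (single \<alpha> (lookup g \<alpha>)) (L ^ d))"
    by (simp flip: apolar_sum_left add: sum_monomials)
  also have "\<dots> = (\<Sum>\<alpha>\<in>keys g. of_nat (\<Prod>i<e. d - i) * single 0 (lookup g \<alpha> * mon_eval (point_of L) \<alpha>) * L ^ (d - e))"
  proof (intro sum.cong refl)
    fix \<alpha> assume "\<alpha> \<in> keys g"
    then have m: "mdeg \<alpha> = e" using assms by (auto simp: homog_def)
    have "apolar (single \<alpha> (lookup g \<alpha>)) (L ^ d) = single 0 (lookup g \<alpha>) *
      (of_nat (\<Prod>i<e. d - i) * single 0 (mon_eval (point_of L) \<alpha>) * L ^ (d - e))"
      unfolding s[of \<alpha> "lookup g \<alpha>"] apolar_monomial_power[OF assms(1)] m by (rule refl)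
    also have "\<dots> = of_nat (\<Prod>i<e. d - i) * (single 0 (lookup g \<alpha>) * single 0 (mon_eval (point_of L) \<alpha>)) * L ^ (d - e)"
      by (simp only: mult.assoc mult.left_commute)
    finally show "apolar (single \<alpha> (lookup g \<alpha>)) (L ^ d)
      = of_nat (\<Prod>i<e. d - i) * single 0 (lookup g \<alpha> * mon_eval (point_of L) \<alpha>) * L ^ (d - e)"
      by (simp add: mult_single)
  qed
  also have "\<dots> = of_nat (\<Prod>i<e. d - i) * single 0 (poly_eval (point_of L) g) * L ^ (d - e)"
    by (simp add: poly_eval_def s0 sum_distrib_left sum_distrib_right)
  finally show ?thesis .
qed

subsection \<open>Existence of Waring decompositions\<close>

text \<open>A Vandermonde argument without determinants: replacing c by 2c and subtracting 2^(n+1)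
  times the original sum removes the top term, and the factors 2^k - 2^(n+1) left on the others are
  invertible in characteristic zero.\<close>

lemma coeffs_in_subspace:
  fixes v :: "nat \<Rightarrow> ('v, 'k::field_char_0) mpoly"
  assumes W: "mp.subspace W"
    and "\<And>c. (\<Sum>k\<le>n. kscale (c ^ k) (v k)) \<in> W"
  shows "\<forall>k\<le>n. v k \<in> W"
  using assms(2)
proof (induction n arbitrary: v)
  case 0
  from 0[of 0] show ?case by simp
next
  case (Suc n)
  define w where "w k = kscale (2 ^ k - 2 ^ Suc n) (v k)" for k
  have "(\<Sum>k\<le>n. kscale (c ^ k) (w k)) \<in> W" for c
  proof -
    have "(\<Sum>k\<le>n. kscale (c ^ k) (w k)) = (\<Sum>k\<le>Suc n. kscale (c ^ k) (w k))"
      by (simp add: w_def)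
    also have "\<dots> = (\<Sum>k\<le>Suc n. kscale ((2 * c) ^ k) (v k) - kscale (2 ^ Suc n) (kscale (c ^ k) (v k)))"
      unfolding w_def by (intro sum.cong refl)
        (simp add: mp.scale_left_diff_distrib mp.scale_right_diff_distrib power_mult_distrib
          right_diff_distrib mult.commute mult.left_commute)
    also have "\<dots> = (\<Sum>k\<le>Suc n. kscale ((2 * c) ^ k) (v k)) - kscale (2 ^ Suc n) (\<Sum>k\<le>Suc n. kscale (c ^ k) (v k))"
      unfolding sum_subtractf mp.scale_sum_right ..
    also have "\<dots> \<in> W" by (intro mp.subspace_diff[OF W] mp.subspace_scale[OF W] Suc.prems)
    finally show ?thesis .
  qed
  then have w: "\<forall>k\<le>n. w k \<in> W" by (rule Suc.IH)
  have v: "v k \<in> W" if "k \<le> n" for k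
  proof -
    have "(2::'k) ^ k - 2 ^ Suc n \<noteq> 0"
    proof
      assume "(2::'k) ^ k - 2 ^ Suc n = 0"
      then have "(of_nat (2 ^ k) :: 'k) = of_nat (2 ^ Suc n)" by simp
      then have "(2::nat) ^ k = 2 ^ Suc n" using of_nat_eq_iff by blast
      then show False using that power_inject_exp[of "2::nat" k "Suc n"] by linarith
    qed
    then have "v k = kscale (inverse (2 ^ k - 2 ^ Suc n)) (w k)" by (simp add: w_def)
    then show ?thesis using mp.subspace_scale[OF W] w that by metis
  qed
  \<comment> \<open>The value at c = 1 recovers the top coefficient once the lower ones are
    known.\<close>
  have "(\<Sum>k\<le>Suc n. kscale (1 ^ k) (v k)) - (\<Sum>k\<le>n. v k) \<in> W"
    using v by (intro mp.subspace_diff[OF W] mp.subspace_sum[OF W] Suc.prems) auto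
  then have "v (Suc n) \<in> W" by simp
  then show ?case using v le_Suc_eq by blast
qed

lemma linear_form_add: "linear_form V L \<Longrightarrow> linear_form V M \<Longrightarrow> linear_form V (L + M)"
  and linear_form_kscale: "linear_form V L \<Longrightarrow> linear_form V (kscale c L)"
  by (simp_all add: linear_form_def polyring_add homog_add polyring_kscale homog_kscale)

lemma power_kscale: "kscale c (p :: ('v, 'k::field) mpoly) ^ n = kscale (c ^ n) (p ^ n)"
  by (induction n)
    (simp_all only: power_0 power_Suc mp.scale_one kscale_mult_left kscale_mult_right mp.scale_scale mult.commute[of c])

text \<open>Polarization: in (cM + L)^(d+1) the coefficient of c is (d+1) M L^d, and coefficients
  lie in the span of the values.\<close>

lemma linear_form_mult_span_powers:
  fixes M p :: "('v, 'k::field_char_0) mpoly"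
  assumes M: "linear_form V M" and p: "p \<in> mp.span {L ^ d |L. linear_form V L}"
  shows "M * p \<in> mp.span {L ^ Suc d |L. linear_form V L}" (is "_ \<in> ?S")
  using p
proof (induction rule: mp.span_induct_alt)
  case base
  then show ?case by (simp add: mp.span_zero)
next
  case (step c x y)
  then obtain L where L: "x = L ^ d" "linear_form V L" by blast
  define v where "v k = of_nat (Suc d choose k) * M ^ k * L ^ (Suc d - k)" for k
  have "(\<Sum>k\<le>Suc d. kscale (c ^ k) (v k)) \<in> ?S" for c
  proof -
    have "(\<Sum>k\<le>Suc d. kscale (c ^ k) (v k)) = (kscale c M + L) ^ Suc d"
      unfolding binomial_ring v_def power_kscale kscale_mult_left kscale_mult_right ..
    moreover have "linear_form V (kscale c M + L)" using M L linear_form_add linear_form_kscale by blast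
    ultimately show ?thesis by (auto intro: mp.span_base)
  qed
  then have v1: "v 1 \<in> ?S" using coeffs_in_subspace[OF mp.subspace_span, where n = "Suc d" and v = v] by auto
  have "v 1 = kscale (of_nat (Suc d)) (M * x)"
    by (simp add: v_def L kscale_conv_mult algebra_simps single_add mult_single flip: single_of_nat)
  moreover have "of_nat (Suc d) \<noteq> (0::'k)" by (rule of_nat_neq_0)
  ultimately have "M * x = kscale (inverse (of_nat (Suc d))) (v 1)" by (simp del: of_nat_Suc)
  then have "M * x \<in> ?S" using mp.span_scale[OF v1] by (simp only:)
  then have "kscale c (M * x) + M * y \<in> ?S" using step by (intro mp.span_add mp.span_scale)
  then show ?case by (simp add: distrib_left kscale_mult_right)
qed

text \<open>A monomial is built up from 1 by multiplying with one variable at a time, each variable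
  being a linear form.\<close>

lemma form_in_span_powers:
  fixes F :: "('v, 'k::field_char_0) mpoly"
  assumes "F \<in> polyring V" "homog d F"
  shows "F \<in> mp.span {L ^ d |L. linear_form V L}"
proof -
  have mono: "keys \<alpha> \<subseteq> V \<Longrightarrow> single \<alpha> 1 \<in> mp.span {L ^ mdeg \<alpha> |L :: ('v, 'k) mpoly. linear_form V L}" for \<alpha>
  proof (induction \<alpha> rule: monomial_induct)
    case zero
    \<comment> \<open>The monomial 1 is the power 0^0 of the zero form.\<close>
    have "linear_form V (0 :: ('v, 'k) mpoly)" by (simp add: linear_form_def)
    then show ?case by (auto intro: mp.span_base)
  next
    case (add v \<alpha>)
    then have "linear_form V (single (single v 1) (1::'k))"
      by (simp add: linear_form_def polyring_single homog_single keys_add_nat)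
    from linear_form_mult_span_powers[OF this, of "single \<alpha> 1" "mdeg \<alpha>"] add
    show ?case by (simp add: mult_single mdeg_add keys_add_nat)
  qed
  have "(\<Sum>\<alpha>\<in>keys F. single \<alpha> (lookup F \<alpha>)) \<in> mp.span {L ^ d |L. linear_form V L}"
  proof (rule mp.span_sum)
    fix \<alpha> assume "\<alpha> \<in> keys F"
    then have "keys \<alpha> \<subseteq> V" "mdeg \<alpha> = d" using assms by (auto simp: polyring_def homog_def)
    then show "single \<alpha> (lookup F \<alpha>) \<in> mp.span {L ^ d |L. linear_form V L}"
      using mono[of \<alpha>] by (subst single_kscale) (auto intro: mp.span_scale)
  qed
  then show ?thesis by (simp add: sum_monomials)
qed

definition power_sum :: "'v set \<Rightarrow> nat \<Rightarrow> nat \<Rightarrow> ('v, 'k::comm_ring_1) mpoly \<Rightarrow> bool" where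
  "power_sum V d r G \<longleftrightarrow> (\<exists>L. (\<forall>j<r. linear_form V (L j)) \<and> G = (\<Sum>j<r. L j ^ d))"

lemma power_sum_0: "power_sum V d 0 0"
  by (simp add: power_sum_def)

lemma power_sum_Suc_iff:
  "power_sum V d (Suc r) G \<longleftrightarrow> (\<exists>H L. power_sum V d r H \<and> linear_form V L \<and> G = H + L ^ d)"
proof
  assume "power_sum V d (Suc r) G"
  then obtain L where L: "\<forall>j<Suc r. linear_form V (L j)" "G = (\<Sum>j<Suc r. L j ^ d)"
    unfolding power_sum_def by (elim exE conjE)
  have "power_sum V d r (\<Sum>j<r. L j ^ d)" unfolding power_sum_def using L(1) less_SucI by blast
  moreover have "linear_form V (L r)" "G = (\<Sum>j<r. L j ^ d) + L r ^ d" using L by simp_all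
  ultimately show "\<exists>H L. power_sum V d r H \<and> linear_form V L \<and> G = H + L ^ d" by blast
next
  assume "\<exists>H L. power_sum V d r H \<and> linear_form V L \<and> G = H + L ^ d"
  then obtain H M where "power_sum V d r H" and M: "linear_form V M" "G = H + M ^ d" by blast
  then obtain L where L: "\<forall>j<r. linear_form V (L j)" "H = (\<Sum>j<r. L j ^ d)"
    unfolding power_sum_def by (elim exE conjE)
  show "power_sum V d (Suc r) G"
    unfolding power_sum_def using L M by (intro exI[of _ "L(r := M)"]) (simp add: less_Suc_eq)
qed

lemma power_sum_add: "power_sum V d r G \<Longrightarrow> power_sum V d s H \<Longrightarrow> power_sum V d (r + s) (G + H)"
proof (induction s arbitrary: H)
  case 0
  then show ?case by (simp add: power_sum_def[of V d 0])
next
  case (Suc s)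
  obtain H' L where H: "power_sum V d s H'" "linear_form V L" "H = H' + L ^ d"
    using Suc.prems(2) unfolding power_sum_Suc_iff by blast
  then have "power_sum V d (r + s) (G + H')" "G + H = (G + H') + L ^ d"
    using Suc.IH[OF Suc.prems(1)] by (simp_all add: add.assoc)
  with H(2) show ?case unfolding add_Suc_right power_sum_Suc_iff by (intro exI conjI)
qed

lemma power_sum_mono: "V \<subseteq> W \<Longrightarrow> power_sum V d r G \<Longrightarrow> power_sum W d r G"
  unfolding power_sum_def linear_form_def
  using polyring_mono[of V W] by (elim exE, intro exI conjI) auto

lemma power_sum_sum:
  assumes "finite I" "\<And>i. i \<in> I \<Longrightarrow> power_sum (V i) d (r i) (F i)"
  shows "power_sum (\<Union>i\<in>I. V i) d (sum r I) (sum F I)"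
proof -
  have "power_sum (\<Union>i\<in>I. V i) d (sum r S) (sum F S)" if "S \<subseteq> I" for S
    using finite_subset[OF that assms(1)] that
  proof (induction S rule: finite_induct)
    case empty then show ?case by (simp add: power_sum_0)
  next
    case (insert i S)
    then have "power_sum (\<Union>i\<in>I. V i) d (r i) (F i)"
      using assms(2)[of i] power_sum_mono[of "V i" "\<Union>i\<in>I. V i"] by blast
    then show ?case using insert by (simp add: power_sum_add)
  qed
  then show ?thesis by blast
qed

lemma alg_closed_root:
  fixes c :: "'k::field"
  assumes "alg_closed_type TYPE('k)" "d \<ge> 1"
  shows "\<exists>x. x ^ d = c"
proof -
  define a :: "nat \<Rightarrow> 'k" where "a i = (if i = d then 1 else if i = 0 then - c else 0)" for i
  have "\<exists>x. (\<Sum>i\<le>d. a i * x ^ i) = 0"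
    using assms(1)[unfolded alg_closed_type_def, rule_format, of d a] assms(2) by (simp add: a_def)
  then obtain x where "(\<Sum>i\<le>d. a i * x ^ i) = 0" by blast
  moreover have "(\<Sum>i\<le>d. a i * x ^ i) = (\<Sum>i\<in>{0, d}. a i * x ^ i)"
    by (rule sum.mono_neutral_right) (auto simp: a_def)
  ultimately show ?thesis using assms(2) by (auto simp: a_def intro!: exI[of _ x])
qed

text \<open>A scalar is absorbed into the linear forms through a d-th root, so power sums form a
  subspace, and this contains the span of the powers. Without existence the \<open>LEAST\<close> in
  \<open>wrank\<close> would carry no information.\<close>

lemma power_sum_exists:
  fixes F :: "('v, 'k::field_char_0) mpoly"
  assumes ac: "alg_closed_type TYPE('k)" and d: "d \<ge> 1" and F: "F \<in> polyring V" "homog d F"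
  shows "\<exists>r. power_sum V d r F"
proof -
  have "mp.subspace {G :: ('v, 'k) mpoly. \<exists>r. power_sum V d r G}"
    unfolding mp.subspace_def
  proof (intro conjI ballI allI)
    show "0 \<in> {G :: ('v, 'k) mpoly. \<exists>r. power_sum V d r G}" using power_sum_0 by blast
    fix x y :: "('v, 'k) mpoly" and c :: 'k
    assume x: "x \<in> {G. \<exists>r. power_sum V d r G}"
    show "y \<in> {G. \<exists>r. power_sum V d r G} \<Longrightarrow> x + y \<in> {G. \<exists>r. power_sum V d r G}"
      using x power_sum_add by blast
    obtain b where b: "b ^ d = c" using alg_closed_root[OF ac d] by blast
    obtain r where "power_sum V d r x" using x by blast
    then obtain L where L: "\<forall>j<r. linear_form V (L j)" "x = (\<Sum>j<r. L j ^ d)"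
      unfolding power_sum_def by (elim exE conjE)
    have "power_sum V d r (kscale c x)" unfolding power_sum_def
      using L b by (intro exI[of _ "\<lambda>j. kscale b (L j)"])
        (simp add: linear_form_kscale power_kscale mp.scale_sum_right)
    then show "kscale c x \<in> {G. \<exists>r. power_sum V d r G}" by blast
  qed
  moreover have "{L ^ d |L. linear_form V L} \<subseteq> {G :: ('v, 'k) mpoly. \<exists>r. power_sum V d r G}"
  proof safe
    fix L :: "('v, 'k) mpoly" assume "linear_form V L"
    then have "power_sum V d (Suc 0) (0 + L ^ d)" unfolding power_sum_Suc_iff using power_sum_0 by blast
    then show "\<exists>r. power_sum V d r (L ^ d)" by auto
  qed
  ultimately show ?thesis using form_in_span_powers[OF F] mp.span_minimal by blast
qed

lemma wrank_eq: "wrank V d G = (LEAST r. power_sum V d r G)"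
  by (simp add: wrank_def power_sum_def)

lemma wrank_le: "power_sum V d r G \<Longrightarrow> wrank V d G \<le> r"
  unfolding wrank_eq by (rule Least_le)

lemma power_sum_wrank: "power_sum V d r G \<Longrightarrow> power_sum V d (wrank V d G) G"
  unfolding wrank_eq by (rule LeastI)

subsection \<open>General position\<close>

text \<open>Restricted to a line, a polynomial function becomes univariate; genericity then reduces
  to avoiding finitely many roots.\<close>

lemma poly_eval_line:
  fixes P :: "('w, 'k::field) mpoly"
  shows "\<exists>q. \<forall>c. poly q c = poly_eval (\<lambda>\<mu>. x \<mu> + c * y \<mu>) P"
  by (rule exI[of _ "\<Sum>\<gamma>\<in>keys P. [:lookup P \<gamma>:] * (\<Prod>\<mu>\<in>keys \<gamma>. [:x \<mu>, y \<mu>:] ^ lookup \<gamma> \<mu>)"])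
    (simp add: poly_eval_def mon_eval_def poly_sum poly_prod)

lemma avoid_roots:
  fixes Q :: "'k::field_char_0 poly set"
  assumes "finite Q" "0 \<notin> Q"
  shows "\<exists>c. \<forall>q\<in>Q. poly q c \<noteq> 0"
proof -
  have "finite (\<Union>q\<in>Q. {c. poly q c = 0})"
    using assms by (intro finite_UN_I) (auto intro: poly_roots_finite)
  then have "(\<Union>q\<in>Q. {c. poly q c = 0}) \<noteq> UNIV" using infinite_UNIV_char_0 by metis
  then show ?thesis by blast
qed

text \<open>Starting in U, one moves along a line t + c h for each further point. Every condition to
  be kept or gained is a nonzero univariate polynomial in c, so some c meets them all.\<close>

lemma general_element:
  fixes U :: "('v, 'k::field_char_0) mpoly set" and a :: "'l \<Rightarrow> 'v \<Rightarrow> 'k"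
  assumes U: "zariski_open_in W U" "U \<noteq> {}"
    and W: "\<And>t c h. t \<in> W \<Longrightarrow> h \<in> A \<Longrightarrow> t + kscale c h \<in> W"
    and S: "finite S" "\<And>l. l \<in> S \<Longrightarrow> \<exists>h\<in>A. poly_eval (a l) h \<noteq> 0"
  shows "\<exists>t\<in>U. \<forall>l\<in>S. poly_eval (a l) t \<noteq> 0"
proof -
  obtain Ps where Ps: "U = {t \<in> W. \<exists>P\<in>Ps. coeff_eval P t \<noteq> 0}"
    using U by (auto simp: zariski_open_in_def)
  \<comment> \<open>A single P is fixed: as long as it stays nonzero and t stays in W, t stays in
    U.\<close>
  obtain u P where P: "u \<in> W" "P \<in> Ps" "coeff_eval P u \<noteq> 0" using U Ps by auto
  have "\<exists>t\<in>W. coeff_eval P t \<noteq> 0 \<and> (\<forall>l\<in>S'. poly_eval (a l) t \<noteq> 0)" if "S' \<subseteq> S" for S'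
    using finite_subset[OF that S(1)] that
  proof (induction S' rule: finite_induct)
    case empty then show ?case using P by auto
  next
    case (insert l S')
    then obtain t where t: "t \<in> W" "coeff_eval P t \<noteq> 0" "\<forall>l\<in>S'. poly_eval (a l) t \<noteq> 0" by auto
    obtain h where h: "h \<in> A" "poly_eval (a l) h \<noteq> 0" using S(2) insert.prems by blast
    obtain q where q: "\<And>c. poly q c = poly_eval (\<lambda>\<mu>. lookup t \<mu> + c * lookup h \<mu>) P"
      using poly_eval_line[of "lookup t" "lookup h" P] by blast
    have q': "poly q c = coeff_eval P (t + kscale c h)" for c
    proof -
      have "lookup (t + kscale c h) = (\<lambda>\<mu>. lookup t \<mu> + c * lookup h \<mu>)" by (simp add: fun_eq_iff lookup_add)
      then show ?thesis by (simp add: q coeff_eval_eq_poly_eval)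
    qed
    \<comment> \<open>The value at a point is affine in c. Its slope is nonzero for the new point,
      its constant term for the earlier ones.\<close>
    define r where "r l' = [:poly_eval (a l') t, poly_eval (a l') h:]" for l'
    have r: "poly (r l') c = poly_eval (a l') (t + kscale c h)" for l' c
      by (simp add: r_def poly_eval_add poly_eval_kscale)
    have "poly q 0 \<noteq> 0" using q' t by simp
    then have "q \<noteq> 0" by auto
    moreover have "r l' \<noteq> 0" if "l' \<in> insert l S'" for l'
      using that h t by (auto simp: r_def)
    ultimately obtain c where "\<forall>q\<in>insert q (r ` insert l S'). poly q c \<noteq> 0"
      using avoid_roots[of "insert q (r ` insert l S')"] insert.hyps by (metis finite.insertI finite_imageI imageE insertE)
    then show ?case using q' r W[OF t(1) h(1), of c] by (intro bexI[of _ "t + kscale c h"]) auto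
  qed
  from this[OF subset_refl] show ?thesis using Ps P by blast
qed

text \<open>Powers of a single scalar suffice as weights: the sum is a polynomial in c whose
  coefficients are the numbers \<open>x l i\<close>.\<close>

lemma general_combination:
  fixes x :: "'l \<Rightarrow> nat \<Rightarrow> 'k::field_char_0"
  assumes "finite S" "finite I" "\<And>l. l \<in> S \<Longrightarrow> \<exists>i\<in>I. x l i \<noteq> 0"
  shows "\<exists>c. \<forall>l\<in>S. (\<Sum>i\<in>I. c ^ i * x l i) \<noteq> 0"
proof -
  define q where "q l = (\<Sum>i\<in>I. monom (x l i) i)" for l
  have "q l \<noteq> 0" if l: "l \<in> S" for l
  proof -
    obtain i where i: "i \<in> I" "x l i \<noteq> 0" using assms(3) l by blast
    have "coeff (q l) i = (\<Sum>i'\<in>I. if i' = i then x l i' else 0)"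
      by (simp add: q_def coeff_sum)
    also have "\<dots> = x l i" using i assms(2) by simp
    finally show ?thesis using i by auto
  qed
  then obtain c where "\<forall>q\<in>q ` S. poly q c \<noteq> 0"
    using avoid_roots[of "q ` S"] assms(1) by (metis finite_imageI imageE)
  then show ?thesis
    by (intro exI[of _ c]) (simp add: q_def poly_sum poly_monom mult.commute)
qed

text \<open>This keeps the lines used in \<open>general_element\<close> inside the ideal.\<close>

lemma ideal_gen_add_generator:
  fixes t :: "('v, 'k::comm_ring_1) mpoly"
  assumes "t \<in> ideal_gen V A" "h \<in> A"
  shows "t + kscale c h \<in> ideal_gen V A"
proof -
  obtain n and b a :: "nat \<Rightarrow> ('v, 'k) mpoly" where t: "\<forall>j<n. b j \<in> polyring V \<and> a j \<in> A" "t = (\<Sum>j<n. b j * a j)"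
    using assms(1) unfolding ideal_gen_def mem_Collect_eq by (elim exE conjE)
  have "single 0 c \<in> polyring V" by (simp add: polyring_single)
  then show ?thesis unfolding ideal_gen_def using t assms(2)
    by (intro CollectI exI[of _ "Suc n"] exI[of _ "b(n := single 0 c)"] exI[of _ "a(n := h)"])
      (auto simp: less_Suc_eq kscale_conv_mult)
qed

subsection \<open>Dimensions of graded pieces\<close>

lemma dim_graded_mono:
  fixes M Q :: "('v, 'k::field) mpoly set"
  assumes "finite V" "mp.subspace M" "mp.subspace Q" "M \<subseteq> Q" "Q \<subseteq> graded_part j (polyring V)"
  shows "mp.dim M \<le> mp.dim Q"
proof -
  obtain B :: "('v, 'k) mpoly set" where B: "finite B" "graded_part j (polyring V) \<subseteq> mp.span B"
    using graded_part_finite_span[OF assms(1)] by blast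
  have "mp.dim M + mp.dim {0 :: ('v, 'k) mpoly} \<le> mp.dim Q + mp.dim {0 :: ('v, 'k) mpoly}"
    using assms B
    by (intro mp.dim_add_le_via_linear[where f = "\<lambda>x. x" and A = "{}" and B = B] mp.linear_ident)
      (auto simp: mp.subspace_0)
  then show ?thesis by simp
qed

lemma dim_graded_part_0: "mp.dim (graded_part 0 (polyring V) :: ('v, 'k::field) mpoly set) \<le> 1"
proof -
  have "graded_part 0 (polyring V) \<subseteq> mp.span {1 :: ('v, 'k) mpoly}"
  proof
    fix p :: "('v, 'k) mpoly" assume "p \<in> graded_part 0 (polyring V)"
    then have "keys p \<subseteq> {0}" by (auto simp: graded_part_def homog_def)
    then have "p = kscale (lookup p 0) 1"
      by (intro poly_mapping_eqI) (auto simp: lookup_one when_def in_keys_iff)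
    then show "p \<in> mp.span {1}" by (metis mp.span_base mp.span_scale singletonI)
  qed
  then show ?thesis using mp.dim_le_card[of _ "{1 :: ('v, 'k) mpoly}"] by simp
qed

lemma single_eq_0_iff: "single \<alpha> c = 0 \<longleftrightarrow> c = 0"
  by (metis lookup_single_eq lookup_zero single_zero)

text \<open>Each point imposes at most one linear condition; coincident or zero points only
  help.\<close>

lemma codim_vanishing_le:
  fixes a :: "'l \<Rightarrow> 'v \<Rightarrow> 'k::field"
  assumes V: "finite V" and X: "finite X"
  shows "mp.dim (graded_part j (polyring V) :: ('v, 'k) mpoly set)
    \<le> mp.dim {g \<in> graded_part j (polyring V). \<forall>l\<in>X. poly_eval (a l) g = 0} + card X"
proof -
  define W where "W X = {g \<in> graded_part j (polyring V). \<forall>l\<in>X. poly_eval (a l) g = 0}" for X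
  obtain B :: "('v, 'k) mpoly set" where B: "finite B" "graded_part j (polyring V) \<subseteq> mp.span B"
    using graded_part_finite_span[OF V] by blast
  have sub: "mp.subspace (W X)" for X
    using subspace_graded_part[OF subspace_polyring, of j V]
    by (auto simp: W_def mp.subspace_def poly_eval_add poly_eval_kscale)
  have "mp.dim (W {}) \<le> mp.dim (W X) + card X"
    using X
  proof (induction X rule: finite_induct)
    case (insert l X)
    \<comment> \<open>The value is returned as a constant polynomial because the dimension
      inequality is stated for endomorphisms.\<close>
    define f :: "('v, 'k) mpoly \<Rightarrow> ('v, 'k) mpoly" where "f g = single 0 (poly_eval (a l) g)" for g
    have lin: "Vector_Spaces.linear kscale kscale f"
      by unfold_locales
        (auto simp: f_def poly_eval_add poly_eval_mult single_add kscale_conv_mult mult_single)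
    have img: "f ` W X \<subseteq> mp.span {1}"
    proof safe
      fix g
      have "f g = kscale (poly_eval (a l) g) 1" by (simp add: f_def kscale_conv_mult)
      then show "f g \<in> mp.span {1}" by (simp add: mp.span_base mp.span_scale)
    qed
    have "mp.dim {0 :: ('v, 'k) mpoly} + mp.dim (W X)
        \<le> mp.dim (mp.span {1 :: ('v, 'k) mpoly}) + mp.dim (W (insert l X))"
      by (rule mp.dim_add_le_via_linear[OF _ sub mp.subspace_span lin _ _ img _ B(1) sub _ _ subset_refl])
        (use B in \<open>auto simp: W_def f_def mp.span_zero single_eq_0_iff\<close>)
    moreover have "mp.dim (mp.span {1 :: ('v, 'k) mpoly}) \<le> 1"
      using mp.dim_le_card[of "{1 :: ('v, 'k) mpoly}" "{1}"] by (simp add: mp.span_superset)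
    ultimately show ?case using insert by simp
  qed simp
  then show ?thesis by (simp add: W_def)
qed

lemma span_image_combination:
  fixes t :: "'i \<Rightarrow> ('v, 'k::field) mpoly"
  assumes "finite S" "x \<in> mp.span (t ` S)"
  shows "\<exists>c. x = (\<Sum>i\<in>S. kscale (c i) (t i))"
proof -
  have "mp.subspace {x. \<exists>c. x = (\<Sum>i\<in>S. kscale (c i) (t i))}"
    unfolding mp.subspace_def
  proof (intro conjI ballI allI)
    show "0 \<in> {x. \<exists>c. x = (\<Sum>i\<in>S. kscale (c i) (t i))}"
      by (intro CollectI exI[of _ "\<lambda>i. 0"]) simp
  next
    fix x y assume "x \<in> {x. \<exists>c. x = (\<Sum>i\<in>S. kscale (c i) (t i))}"
      "y \<in> {x. \<exists>c. x = (\<Sum>i\<in>S. kscale (c i) (t i))}"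
    then obtain c c' where "x = (\<Sum>i\<in>S. kscale (c i) (t i))" "y = (\<Sum>i\<in>S. kscale (c' i) (t i))" by blast
    then show "x + y \<in> {x. \<exists>c. x = (\<Sum>i\<in>S. kscale (c i) (t i))}"
      by (intro CollectI exI[of _ "\<lambda>i. c i + c' i"]) (simp add: mp.scale_left_distrib sum.distrib)
  next
    fix b x assume "x \<in> {x. \<exists>c. x = (\<Sum>i\<in>S. kscale (c i) (t i))}"
    then obtain c where "x = (\<Sum>i\<in>S. kscale (c i) (t i))" by blast
    then show "kscale b x \<in> {x. \<exists>c. x = (\<Sum>i\<in>S. kscale (c i) (t i))}"
      by (intro CollectI exI[of _ "\<lambda>i. b * c i"]) (simp add: mp.scale_sum_right)
  qed
  moreover have "t ` S \<subseteq> {x. \<exists>c. x = (\<Sum>i\<in>S. kscale (c i) (t i))}"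
  proof safe
    fix i assume i: "i \<in> S"
    have "(\<Sum>i'\<in>S. kscale (if i' = i then 1 else 0) (t i')) = (\<Sum>i'\<in>S. if i' = i then t i' else 0)"
      by (intro sum.cong) auto
    then show "\<exists>c. t i = (\<Sum>i\<in>S. kscale (c i) (t i))"
      using i assms(1) by (intro exI[of _ "\<lambda>i'. if i' = i then 1 else 0"]) simp
  qed
  ultimately show ?thesis using assms(2) mp.span_minimal by blast
qed

text \<open>For elements independent modulo J, their span meets J only in 0. Injectivity of
  \<open>t\<close> comes with the independence.\<close>

lemma dim_add_independent_le:
  fixes t :: "'i \<Rightarrow> ('v, 'k::field) mpoly"
  assumes V: "finite V" and I: "finite I"
    and J: "mp.subspace J" "J \<subseteq> K" and K: "mp.subspace K" "K \<subseteq> graded_part j (polyring V)"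
    and t: "\<And>i. i \<in> I \<Longrightarrow> t i \<in> K"
    and ind: "\<And>c. (\<Sum>i\<in>I. kscale (c i) (t i)) \<in> J \<Longrightarrow> \<forall>i\<in>I. c i = 0"
  shows "mp.dim J + card I \<le> mp.dim K"
proof -
  have "\<not> mp.dependent (t ` S) \<and> card (t ` S) = card S" if "S \<subseteq> I" for S
    using finite_subset[OF that I] that
  proof (induction S rule: finite_induct)
    case empty then show ?case by (simp add: mp.independent_empty)
  next
    case (insert i S)
    have "t i \<notin> mp.span (t ` S)"
    proof
      assume "t i \<in> mp.span (t ` S)"
      then obtain c where c: "t i = (\<Sum>k\<in>S. kscale (c k) (t k))"
        using span_image_combination insert.hyps by blast
      \<comment> \<open>The dependence, extended by 0 to all of I, is a combination equal to 0 and
        thus in J, yet its coefficient at i is -1.\<close>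
      define c' where "c' k = (if k = i then - 1 else if k \<in> S then c k else 0)" for k
      have "(\<Sum>k\<in>I. kscale (c' k) (t k)) = (\<Sum>k\<in>insert i S. kscale (c' k) (t k))"
        using insert.prems I by (intro sum.mono_neutral_right) (auto simp: c'_def)
      also have "\<dots> = kscale (c' i) (t i) + (\<Sum>k\<in>S. kscale (c' k) (t k))"
        using insert.hyps by simp
      also have "(\<Sum>k\<in>S. kscale (c' k) (t k)) = (\<Sum>k\<in>S. kscale (c k) (t k))"
        using insert.hyps by (intro sum.cong) (auto simp: c'_def)
      also have "kscale (c' i) (t i) + \<dots> = 0" using c by (simp add: c'_def)
      finally have "c' i = 0" using ind[of c'] mp.subspace_0[OF J(1)] insert.prems by auto
      then show False by (simp add: c'_def)
    qed
    then have "t i \<notin> t ` S" using mp.span_base by metis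
    then show ?case using insert mp.independent_insertI[OF \<open>t i \<notin> mp.span (t ` S)\<close>] by simp
  qed
  then have tI: "\<not> mp.dependent (t ` I)" "card (t ` I) = card I" by auto
  obtain B :: "('v, 'k) mpoly set" where B: "finite B" "graded_part j (polyring V) \<subseteq> mp.span B"
    using graded_part_finite_span[OF V] by blast
  have tK: "mp.span (t ` I) \<subseteq> K" using t K(1) by (intro mp.span_minimal) auto
  have "mp.dim J + mp.dim (mp.span (t ` I)) \<le> mp.dim K + mp.dim {0 :: ('v, 'k) mpoly}"
  proof (rule mp.dim_add_le_via_linear[where f = "\<lambda>x. x" and A = B and B = B])
    fix q assume q: "q \<in> mp.span (t ` I)" "q \<in> J"
    then obtain c where c: "q = (\<Sum>i\<in>I. kscale (c i) (t i))" using span_image_combination I by blast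
    then have "\<forall>i\<in>I. c i = 0" using ind q by blast
    then show "q \<in> {0}" using c by simp
  qed (use J K B tK mp.linear_ident mp.span_zero in auto)
  moreover have "mp.dim {0 :: ('v, 'k) mpoly} = 0"
    using mp.dim_le_card[of "{0 :: ('v, 'k) mpoly}" "{}"] by simp
  ultimately show ?thesis using tI mp.dim_span_eq_card_independent[of "t ` I"] by simp
qed

subsection \<open>Ideals\<close>

lemma subspace_perp: "mp.subspace (perp V (F :: ('v, 'k::field) mpoly))"
  by (auto simp: mp.subspace_def perp_def polyring_add polyring_kscale apolar_add_left apolar_kscale)

lemma subspace_colon: "mp.subspace J \<Longrightarrow> mp.subspace (colon V (J :: ('v, 'k::field) mpoly set) I)"
  by (auto simp: mp.subspace_def colon_def polyring_add polyring_kscale distrib_right kscale_mult_left)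

lemma subspace_ideal_plus_principal:
  fixes J :: "('v, 'k::field) mpoly set"
  assumes "mp.subspace J"
  shows "mp.subspace (ideal_plus_principal V J t)"
  unfolding mp.subspace_def
proof (intro conjI ballI allI)
  show "0 \<in> ideal_plus_principal V J t"
    using mp.subspace_0[OF assms] unfolding ideal_plus_principal_def
    by (intro CollectI exI[of _ 0]) simp
next
  fix x y assume "x \<in> ideal_plus_principal V J t" "y \<in> ideal_plus_principal V J t"
  then obtain a b a' b' where "x = a + b * t" "y = a' + b' * t" "a \<in> J" "a' \<in> J"
    "b \<in> polyring V" "b' \<in> polyring V" unfolding ideal_plus_principal_def by blast
  moreover from this have "x + y = (a + a') + (b + b') * t" by (simp add: algebra_simps)
  ultimately show "x + y \<in> ideal_plus_principal V J t"
    using mp.subspace_add[OF assms] polyring_add unfolding ideal_plus_principal_def by blast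
next
  fix c x assume "x \<in> ideal_plus_principal V J t"
  then obtain a b where "x = a + b * t" "a \<in> J" "b \<in> polyring V"
    unfolding ideal_plus_principal_def by blast
  moreover from this have "kscale c x = kscale c a + kscale c b * t"
    by (simp add: mp.scale_right_distrib kscale_mult_left)
  ultimately show "kscale c x \<in> ideal_plus_principal V J t"
    using mp.subspace_scale[OF assms] polyring_kscale unfolding ideal_plus_principal_def by blast
qed

lemma ideal_plus_principal_base: "x \<in> J \<Longrightarrow> x \<in> ideal_plus_principal V J t"
  unfolding ideal_plus_principal_def by (intro CollectI exI[of _ x] exI[of _ 0]) simp

lemma ideal_plus_principal_mult:
  "0 \<in> J \<Longrightarrow> b \<in> polyring V \<Longrightarrow> b * t \<in> ideal_plus_principal V J t"
  unfolding ideal_plus_principal_def by (intro CollectI exI[of _ 0] exI[of _ b]) simp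

lemma ideal_gen_polyring:
  assumes "A \<subseteq> polyring V" shows "ideal_gen V A \<subseteq> polyring V"
  using assms by (auto simp: ideal_gen_def intro!: polyring_sum polyring_mult)

text \<open>Generators suffice: coefficients of an element of the ideal can be applied last, where
  they act on 0.\<close>

lemma in_colon_perpI:
  fixes F :: "('v, 'k::comm_ring_1) mpoly"
  assumes A: "A \<subseteq> polyring V" and g: "g \<in> polyring V"
    and kill: "\<And>h. h \<in> A \<Longrightarrow> apolar (g * h) F = 0"
  shows "g \<in> colon V (perp V F) (ideal_gen V A)"
  unfolding colon_def perp_def
proof (intro CollectI conjI ballI g)
  fix h assume h: "h \<in> ideal_gen V A"
  then show "g * h \<in> polyring V" using ideal_gen_polyring[OF A] g polyring_mult by blast
  obtain n and b c :: "nat \<Rightarrow> ('v, 'k) mpoly"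
    where bc: "\<forall>j<n. b j \<in> polyring V \<and> c j \<in> A" "h = (\<Sum>j<n. b j * c j)"
    using h unfolding ideal_gen_def mem_Collect_eq by (elim exE conjE)
  have "apolar (g * h) F = (\<Sum>j<n. apolar (b j * (g * c j)) F)"
    by (simp add: bc sum_distrib_left apolar_sum_left mult.left_commute)
  also have "\<dots> = 0" using bc kill by (simp add: apolar_mult[of "b _"])
  finally show "apolar (g * h) F = 0" .
qed

text \<open>Differences over a step of e collapse to a window of e consecutive values of h, each at
  most s; the m gained in degree 0 is repaid in degree e. Integers keep the differences
  untruncated.\<close>

lemma telescoping_bound:
  fixes R h :: "nat \<Rightarrow> int"
  assumes e: "e \<ge> 1" and R: "\<And>j. R j \<ge> 0" and R0: "R 0 \<le> m"
    and lt: "\<And>j. 1 \<le> j \<Longrightarrow> j < e \<Longrightarrow> R j \<le> h j"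
    and eq: "R e \<le> h e - m"
    and gt: "\<And>j. e < j \<Longrightarrow> R j \<le> h j - h (j - e)"
    and hs: "\<And>j. h j \<le> s"
  shows "(\<Sum>j<N. R j) \<le> int e * s"
proof -
  have main: "(\<Sum>j<e + Suc k. R j) \<le> (\<Sum>j=Suc k..k + e. h j)" for k
  proof (induction k)
    case 0
    have "(\<Sum>j<e + Suc 0. R j) = R 0 + (\<Sum>j=1..<e. R j) + R e"
      using e by (simp add: lessThan_atLeast0 sum.atLeast_Suc_lessThan)
    also have "\<dots> \<le> m + (\<Sum>j=1..<e. h j) + (h e - m)"
      using R0 eq lt by (intro add_mono sum_mono) auto
    also have "\<dots> = (\<Sum>j=1..e. h j)" using e sum.last_plus[of 1 e h] by simp
    finally show ?case by simp
  next
    case (Suc k)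
    have "(\<Sum>j<e + Suc (Suc k). R j) = (\<Sum>j<e + Suc k. R j) + R (e + Suc k)" by simp
    also have "\<dots> \<le> (\<Sum>j=Suc k..k + e. h j) + (h (e + Suc k) - h (Suc k))"
      using Suc gt[of "e + Suc k"] by simp
    also have "(\<Sum>j=Suc k..k + e. h j) = h (Suc k) + (\<Sum>j=Suc (Suc k)..k + e. h j)"
      using e by (simp add: sum.atLeast_Suc_atMost)
    also have "\<dots> + (h (e + Suc k) - h (Suc k)) = (\<Sum>j=Suc (Suc k)..Suc k + e. h j)"
      using e by (simp add: add.commute)
    finally show ?case .
  qed
  \<comment> \<open>Nonnegativity allows the range to grow to a length for which the window bound is
    available.\<close>
  have "(\<Sum>j<N. R j) \<le> (\<Sum>j<e + Suc N. R j)"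
    using R by (intro sum_mono2) auto
  also have "\<dots> \<le> (\<Sum>j=Suc N..N + e. h j)" by (rule main)
  also have "\<dots> \<le> (\<Sum>j=Suc N..N + e. s)" using hs by (intro sum_mono) auto
  finally show ?thesis by simp
qed

subsection \<open>The lower bound\<close>

text \<open>Setting the variables of block i to zero kills h, as its degree is positive, so h acts
  as 0 on every other summand.\<close>

lemma apolar_disjoint:
  fixes F :: "'i \<Rightarrow> ('v, 'k::comm_ring_1) mpoly"
  assumes "finite I" "\<And>i j. i \<in> I \<Longrightarrow> j \<in> I \<Longrightarrow> i \<noteq> j \<Longrightarrow> V i \<inter> V j = {}"
    and "\<And>i. i \<in> I \<Longrightarrow> F i \<in> polyring (V i)"
    and "i \<in> I" "h \<in> polyring (V i)" "homog e h" "e \<ge> 1"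
  shows "apolar h (\<Sum>i\<in>I. F i) = apolar h (F i)"
proof -
  have "apolar h (F j) = 0" if "j \<in> I - {i}" for j
  proof -
    have "apolar h (F j) = apolar (restrict_vars (V j) h) (F j)"
      using assms that by (intro apolar_restrict_vars) auto
    also have "restrict_vars (V j) h = 0"
      using assms that by (intro restrict_vars_disjoint[of h "V i" "V j" e]) auto
    finally show ?thesis by simp
  qed
  then show ?thesis
    using assms(1,4) unfolding apolar_sum_right
    by (subst sum.remove[of I i]) (simp_all add: sum.neutral)
qed

lemma apolar_power_sum_vanishing:
  assumes "homog e g" "\<And>l. l < s \<Longrightarrow> homog 1 (L l)"
    and "\<And>l. l < s \<Longrightarrow> poly_eval (point_of (L l)) g = 0"
  shows "apolar g (\<Sum>l<s. L l ^ d) = 0"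
  using assms by (simp add: apolar_sum_right apolar_power)

text \<open>The general combination called t in the overview is \<open>u\<close> here, and
  \<open>M i\<close> is B_i + (t_i). Partial sums are bounded uniformly in N, so convergence matters
  only to the caller.\<close>

lemma hilbert_sum_le:
  fixes F :: "nat \<Rightarrow> ('v, 'k::field_char_0) mpoly"
  assumes I: "finite I"
    and V: "\<And>i. i \<in> I \<Longrightarrow> finite (V i)"
    and disj: "\<And>i j. i \<in> I \<Longrightarrow> j \<in> I \<Longrightarrow> i \<noteq> j \<Longrightarrow> V i \<inter> V j = {}"
    and e: "1 \<le> e" "e < d"
    and F: "\<And>i. i \<in> I \<Longrightarrow> F i \<in> polyring (V i)" "\<And>i. i \<in> I \<Longrightarrow> homog d (F i)"
    and perp: "\<And>i. i \<in> I \<Longrightarrow> graded_part e (perp (V i) (F i)) = {0}"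
    and L: "\<And>l. l < s \<Longrightarrow> homog 1 (L l)" "(\<Sum>i\<in>I. F i) = (\<Sum>l<s. L l ^ d)"
    and A: "\<And>i. i \<in> I \<Longrightarrow> A i \<subseteq> graded_part e (polyring (V i))"
    and t: "\<And>i. i \<in> I \<Longrightarrow> t i \<in> graded_part e (ideal_gen (V i) (A i))" "\<And>i. i \<in> I \<Longrightarrow> t i \<noteq> 0"
    and general: "\<And>i l. i \<in> I \<Longrightarrow> l < s \<Longrightarrow> \<exists>h\<in>A i. poly_eval (point_of (L l)) h \<noteq> 0
      \<Longrightarrow> poly_eval (point_of (L l)) (t i) \<noteq> 0"
  shows "(\<Sum>j<N. \<Sum>i\<in>I. hilbert_fun (V i)
    (ideal_plus_principal (V i) (colon (V i) (perp (V i) (F i)) (ideal_gen (V i) (A i))) (t i)) j) \<le> e * s"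
proof -
  define W where "W = (\<Union>i\<in>I. V i)"
  define pe where "pe l = poly_eval (point_of (L l))" for l
  define B where "B i = colon (V i) (perp (V i) (F i)) (ideal_gen (V i) (A i))" for i
  define M where "M i = ideal_plus_principal (V i) (B i) (t i)" for i
  define X where "X = {l. l < s \<and> (\<exists>i\<in>I. pe l (t i) \<noteq> 0)}"
  define T where "T j = (graded_part j (polyring W) :: ('v, 'k) mpoly set)" for j
  define J where "J j = {g \<in> T j. \<forall>l\<in>X. pe l g = 0}" for j
  \<comment> \<open>Conditions for a subset S of the blocks only, so that blocks can be added one at
    a time.\<close>
  define KS where "KS S j = {g \<in> T j. \<forall>i\<in>S. restrict_vars (V i) g \<in> M i}" for S j
  define K where "K = KS I"
  have finW: "finite W" using I V by (simp add: W_def)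
  have VW: "polyring (V i) \<subseteq> polyring W" if "i \<in> I" for i
    using that by (intro polyring_mono) (auto simp: W_def)
  have finX: "finite X" "card X \<le> s"
    using card_mono[of "{..<s}" X] by (auto simp: X_def intro: finite_subset[of _ "{..<s}"])
  have AV: "A i \<subseteq> polyring (V i)" if "i \<in> I" for i using A[OF that] by (auto simp: graded_part_def)
  have tV: "t i \<in> polyring (V i)" "homog e (t i)" "t i \<in> ideal_gen (V i) (A i)" if "i \<in> I" for i
    using t(1)[OF that] ideal_gen_polyring[OF AV[OF that]] by (auto simp: graded_part_def)
  have Avan: "pe l h = 0" if "i \<in> I" "h \<in> A i" "l < s" "l \<notin> X" for i h l
    using general[OF that(1,3)] that by (auto simp: X_def pe_def)
  have tvan: "pe l (t i) = 0" if "i \<in> I" "l < s" "l \<notin> X" for i l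
    using that by (auto simp: X_def)
  have res_t: "restrict_vars (V i) (t i') = (if i' = i then t i else 0)" if "i \<in> I" "i' \<in> I" for i i'
    using restrict_vars_id[OF tV(1)[OF that(1)]] disj[OF that] e
      restrict_vars_disjoint[OF tV(1)[OF that(2)] _ tV(2)[OF that(2)], of "V i"] by auto
  have subB: "mp.subspace (B i)" for i unfolding B_def by (intro subspace_colon subspace_perp)
  have subM: "mp.subspace (M i)" for i unfolding M_def by (intro subspace_ideal_plus_principal subB)
  have subT: "mp.subspace (T j)" for j unfolding T_def by (intro subspace_graded_part subspace_polyring)
  have subJ: "mp.subspace (J j)" for j
    using subT[of j] by (auto simp: J_def mp.subspace_def poly_eval_add poly_eval_kscale pe_def)
  have subKS: "mp.subspace (KS S j)" for S j
    using subT[of j] subM by (auto simp: KS_def mp.subspace_def restrict_vars_add restrict_vars_kscale)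
  have KT: "KS S j \<subseteq> T j" for S j by (auto simp: KS_def)

  \<comment> \<open>The product g h vanishes at every point: on X because of g, elsewhere because of
    the generator h. Hence it annihilates F, and h has already removed all summands but F_i.\<close>
  have JB: "restrict_vars (V i) g \<in> B i" if g: "g \<in> J j" and i: "i \<in> I" for g i j
    unfolding B_def
  proof (rule in_colon_perpI[OF AV[OF i] restrict_vars_in_polyring])
    fix h assume h: "h \<in> A i"
    then have hV: "h \<in> polyring (V i)" "homog e h" using A[OF i] by (auto simp: graded_part_def)
    have "apolar (restrict_vars (V i) g * h) (F i) = apolar g (apolar h (F i))"
      using apolar_restrict_vars[OF apolar_polyring[OF F(1)[OF i]], of g h] by (simp add: apolar_mult)
    also have "\<dots> = apolar (g * h) (\<Sum>l<s. L l ^ d)"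
      unfolding apolar_mult L(2)[symmetric]
      using apolar_disjoint[where V = V and F = F, OF I disj F(1) i hV e(1)] by simp
    also have "\<dots> = 0"
    proof (rule apolar_power_sum_vanishing[of "j + e"])
      show "homog (j + e) (g * h)" using g hV by (intro homog_mult) (auto simp: J_def T_def graded_part_def)
      fix l assume l: "l < s"
      then have "pe l g = 0 \<or> pe l h = 0" using g Avan[OF i h l] by (auto simp: J_def)
      then show "poly_eval (point_of (L l)) (g * h) = 0" by (auto simp: poly_eval_mult pe_def)
    qed (use L in auto)
    finally show "apolar (restrict_vars (V i) g * h) (F i) = 0" .
  qed
  have JK: "J j \<subseteq> K j" for j
  proof
    fix g assume g: "g \<in> J j"
    have "restrict_vars (V i) g \<in> M i" if "i \<in> I" for i
      unfolding M_def by (intro ideal_plus_principal_base JB[OF g that])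
    then show "g \<in> K j" using g by (simp add: K_def KS_def J_def)
  qed

  have tK: "t i \<in> K e" if i: "i \<in> I" for i
  proof -
    have "restrict_vars (V i') (t i) \<in> M i'" if i': "i' \<in> I" for i'
    proof (cases "i' = i")
      case True
      then show ?thesis using res_t[OF i i] mp.subspace_0[OF subB]
        ideal_plus_principal_mult[of "B i" 1 "V i" "t i"] by (simp add: M_def)
    next
      case False
      then show ?thesis using res_t[OF i' i] mp.subspace_0[OF subM] by simp
    qed
    then show ?thesis using tV[OF i] VW[OF i] by (auto simp: K_def KS_def T_def graded_part_def)
  qed

  have indep: "\<forall>i\<in>I. c i = 0" if c: "(\<Sum>i\<in>I. kscale (c i) (t i)) \<in> J e" for c
  proof -
    define g where "g = (\<Sum>i\<in>I. kscale (c i) (t i))"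
    have "apolar g (\<Sum>l<s. L l ^ d) = 0"
    proof (rule apolar_power_sum_vanishing[of e])
      show "homog e g" using c by (auto simp: g_def J_def T_def graded_part_def)
      fix l assume l: "l < s"
      show "poly_eval (point_of (L l)) g = 0"
      proof (cases "l \<in> X")
        case True
        then show ?thesis using c by (auto simp: g_def J_def pe_def)
      next
        case False
        then show ?thesis using tvan[OF _ l False]
          by (simp add: g_def poly_eval_sum poly_eval_kscale pe_def)
      qed
    qed (use L in auto)
    moreover have "apolar g (\<Sum>i\<in>I. F i) = (\<Sum>i\<in>I. apolar (kscale (c i) (t i)) (F i))"
      unfolding g_def apolar_sum_left
      using tV by (intro sum.cong refl apolar_disjoint[where V = V and F = F, OF I disj F(1) _ _ _ e(1)] polyring_kscale homog_kscale) auto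
    ultimately have 0: "(\<Sum>i\<in>I. apolar (kscale (c i) (t i)) (F i)) = 0" using L by simp
    show ?thesis
    proof
      fix i assume i: "i \<in> I"
      \<comment> \<open>Restriction to block i isolates one summand of the vanishing sum; the others
        have degree d - e > 0 in foreign variables.\<close>
      have "restrict_vars (V i) (apolar (kscale (c i') (t i')) (F i')) =
          (if i' = i then apolar (kscale (c i) (t i)) (F i) else 0)" if i': "i' \<in> I" for i'
      proof (cases "i' = i")
        case True
        then show ?thesis using apolar_polyring[OF F(1)[OF i]] by (simp add: restrict_vars_id)
      next
        case False
        have "homog (d - e) (apolar (kscale (c i') (t i')) (F i'))"
          using tV[OF i'] F(2)[OF i'] by (intro homog_apolar homog_kscale)
        then show ?thesis using False disj[OF i i'] e apolar_polyring[OF F(1)[OF i']]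
          by (subst restrict_vars_disjoint[where W = "V i'" and d = "d - e"]) auto
      qed
      then have "restrict_vars (V i) (\<Sum>i'\<in>I. apolar (kscale (c i') (t i')) (F i'))
          = (\<Sum>i'\<in>I. if i' = i then apolar (kscale (c i) (t i)) (F i) else 0)"
        unfolding restrict_vars_sum by (intro sum.cong refl) auto
      also have "\<dots> = apolar (kscale (c i) (t i)) (F i)" using i I by simp
      finally have "apolar (kscale (c i) (t i)) (F i) = 0" using 0 by simp
      then have "kscale (c i) (t i) \<in> graded_part e (perp (V i) (F i))"
        using tV[OF i] by (simp add: graded_part_def perp_def polyring_kscale homog_kscale)
      then have "kscale (c i) (t i) = 0" using perp[OF i] by blast
      then show "c i = 0" using t(2)[OF i] by simp
    qed
  qed

  have "\<exists>c. \<forall>l\<in>X. (\<Sum>i\<in>I. c ^ i * pe l (t i)) \<noteq> 0"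
    by (rule general_combination[OF finX(1) I]) (simp add: X_def)
  then obtain c where c: "\<forall>l\<in>X. (\<Sum>i\<in>I. c ^ i * pe l (t i)) \<noteq> 0" by blast
  define u where "u = (\<Sum>i\<in>I. kscale (c ^ i) (t i))"
  have u: "u \<in> polyring W" "homog e u"
    unfolding u_def
    using tV VW by (blast intro: polyring_sum homog_sum polyring_kscale homog_kscale)+
  have pu: "pe l u \<noteq> 0" if "l \<in> X" for l
    using c that by (simp add: u_def poly_eval_sum poly_eval_kscale pe_def)
  have res_u: "restrict_vars (V i) u = kscale (c ^ i) (t i)" if i: "i \<in> I" for i
  proof -
    have "restrict_vars (V i) u = (\<Sum>i'\<in>I. if i' = i then kscale (c ^ i) (t i) else 0)"
      unfolding u_def restrict_vars_sum restrict_vars_kscale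
      using res_t[OF i] by (intro sum.cong refl) auto
    then show ?thesis using i I by simp
  qed
  \<comment> \<open>Restricted to block i, u becomes a multiple of t_i, so p u lands in the
    principal part of \<open>M i\<close>.\<close>
  have uK: "p * u \<in> K j" if p: "p \<in> T (j - e)" and j: "j \<ge> e" for p j
  proof -
    have "restrict_vars (V i) (p * u) \<in> M i" if i: "i \<in> I" for i
    proof -
      have "restrict_vars (V i) (p * u) = kscale (c ^ i) (restrict_vars (V i) p) * t i"
        by (simp add: restrict_vars_mult res_u[OF i] kscale_mult_left kscale_mult_right)
      then show ?thesis unfolding M_def
        using ideal_plus_principal_mult[OF mp.subspace_0[OF subB] polyring_kscale[OF restrict_vars_in_polyring]]
        by simp
    qed
    moreover have "homog (j - e + e) (p * u)"
      using p u by (intro homog_mult) (auto simp: T_def graded_part_def)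
    ultimately show ?thesis using p u j
      by (auto simp: K_def KS_def T_def graded_part_def intro: polyring_mult)
  qed

  have dims: "\<exists>B :: ('v, 'k) mpoly set. finite B \<and> T j \<subseteq> mp.span B" for j
    unfolding T_def using graded_part_finite_span[OF finW] by metis

  \<comment> \<open>Adding block i to S costs at least its Hilbert function: forms of positive
    degree in block i satisfy all conditions of the other blocks, and they satisfy the new one only
    if they lie in \<open>M i\<close>.\<close>
  have right: "(\<Sum>i\<in>I. hilbert_fun (V i) (M i) j) + mp.dim (K j) \<le> mp.dim (T j)" if j: "j \<ge> 1" for j
  proof -
    have "(\<Sum>i\<in>S. hilbert_fun (V i) (M i) j) + mp.dim (KS S j) \<le> mp.dim (T j)" if "S \<subseteq> I" for S
      using finite_subset[OF that I] that
    proof (induction S rule: finite_induct)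
      case empty then show ?case by (simp add: KS_def)
    next
      case (insert i S)
      then have i: "i \<in> I" by simp
      define Q :: "('v, 'k) mpoly set" where "Q = graded_part j (polyring (V i))"
      have QT: "Q \<subseteq> T j" using VW[OF i] by (auto simp: Q_def T_def graded_part_def)
      have subQ: "mp.subspace Q" unfolding Q_def by (intro subspace_graded_part subspace_polyring)
      have Mi: "graded_part j (M i) \<subseteq> Q"
      proof -
        have "M i \<subseteq> polyring (V i)"
          using tV(1)[OF i] by (auto simp: M_def B_def ideal_plus_principal_def colon_def intro!: polyring_add polyring_mult)
        then show ?thesis by (auto simp: Q_def graded_part_def)
      qed
      have KQ: "Q \<subseteq> KS S j"
      proof
        fix q assume q: "q \<in> Q"
        have "restrict_vars (V i') q = 0" if "i' \<in> S" for i'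
          using q that insert j disj[of i' i]
          by (intro restrict_vars_disjoint[of q "V i" "V i'" j]) (auto simp: Q_def graded_part_def)
        then show "q \<in> KS S j" using q QT mp.subspace_0[OF subM] by (auto simp: KS_def)
      qed
      obtain B where B: "finite B" "T j \<subseteq> mp.span B" using dims by blast
      have "mp.dim (KS (insert i S) j) + mp.dim Q \<le> mp.dim (KS S j) + mp.dim (graded_part j (M i))"
      proof (rule mp.dim_add_le_via_linear[where f = "\<lambda>x. x",
            OF subKS subspace_graded_part[OF subM] subKS mp.linear_ident Mi _ _ _ B(1) subQ _ B(1)])
        fix q assume "q \<in> Q" "q \<in> KS (insert i S) j"
        then show "q \<in> graded_part j (M i)"
          using restrict_vars_id[of q "V i"] by (auto simp: Q_def graded_part_def KS_def)
      qed (use B QT KT[of S j] KQ in \<open>auto simp: KS_def\<close>)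
      \<comment> \<open>Ensures that the natural subtraction in \<open>hilbert_fun\<close> is not
        truncated.\<close>
      moreover have "mp.dim (graded_part j (M i)) \<le> mp.dim Q"
        by (rule dim_graded_mono[OF V[OF i] subspace_graded_part[OF subM] subQ Mi, of j])
          (simp add: Q_def)
      ultimately show ?case using insert by (simp add: hilbert_fun_def kdim_eq Q_def)
    qed
    then show ?thesis by (simp add: K_def)
  qed
  have hs: "mp.dim (T j) \<le> mp.dim (J j) + s" for j
    using codim_vanishing_le[OF finW finX(1), of j "\<lambda>l. point_of (L l)"] finX(2)
    by (simp add: T_def J_def pe_def)
  have JKdim: "mp.dim (J j) \<le> mp.dim (K j)" for j
    using dim_graded_mono[OF finW subJ subKS JK[unfolded K_def] KT[unfolded T_def]] by (simp add: K_def)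
  have eqdim: "mp.dim (J e) + card I \<le> mp.dim (K e)"
    using indep tK JK KT by (intro dim_add_independent_le[OF finW I subJ, where j = e]) (auto simp: K_def subKS T_def)
  \<comment> \<open>Multiplication by u sends T_(j-e) into K_j and is injective modulo J because u
    has no zero on X.\<close>
  have gtdim: "mp.dim (J j) + mp.dim (T (j - e)) \<le> mp.dim (K j) + mp.dim (J (j - e))" if j: "j \<ge> e" for j
  proof -
    obtain B where B: "finite B" "T j \<subseteq> mp.span B" using dims by blast
    obtain B' where B': "finite B'" "T (j - e) \<subseteq> mp.span B'" using dims by blast
    show ?thesis
    proof (rule mp.dim_add_le_via_linear[where f = "\<lambda>p. p * u" and A = B' and B = B])
      show "Vector_Spaces.linear kscale kscale (\<lambda>p. p * u)"
        by unfold_locales (simp_all add: distrib_right kscale_mult_left)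
      fix q assume "q \<in> T (j - e)" "q * u \<in> J j"
      then show "q \<in> J (j - e)" using pu by (auto simp: J_def poly_eval_mult pe_def)
    qed (use subJ subKS subT B B' JK KT uK[OF _ j] KT[of I j, THEN subsetD] in
        \<open>auto simp: J_def K_def\<close>)
  qed
  have zero: "(\<Sum>i\<in>I. hilbert_fun (V i) (M i) 0) \<le> card I"
  proof -
    have "(\<Sum>i\<in>I. hilbert_fun (V i) (M i) 0) \<le> (\<Sum>i\<in>I. 1)"
      by (intro sum_mono) (metis hilbert_fun_def kdim_eq dim_graded_part_0 diff_le_self order_trans)
    then show ?thesis by simp
  qed
  have "(\<Sum>j<N. int (\<Sum>i\<in>I. hilbert_fun (V i) (M i) j)) \<le> int e * int s"
  proof (rule telescoping_bound[where h = "\<lambda>j. int (mp.dim (T j)) - int (mp.dim (J j))" and m = "int (card I)"])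
    fix j assume "e < j"
    then show "int (\<Sum>i\<in>I. hilbert_fun (V i) (M i) j) \<le> int (mp.dim (T j)) - int (mp.dim (J j))
      - (int (mp.dim (T (j - e))) - int (mp.dim (J (j - e))))"
      using right[of j] gtdim[of j] by linarith
  next
    fix j :: nat assume "1 \<le> j"
    then show "int (\<Sum>i\<in>I. hilbert_fun (V i) (M i) j) \<le> int (mp.dim (T j)) - int (mp.dim (J j))"
      using right[of j] JKdim[of j] by linarith
  next
    fix j
    show "int (mp.dim (T j)) - int (mp.dim (J j)) \<le> int s" using hs[of j] by linarith
  next
    show "int (\<Sum>i\<in>I. hilbert_fun (V i) (M i) e) \<le> int (mp.dim (T e)) - int (mp.dim (J e)) - int (card I)"
      using right[of e] eqdim e by linarith
  qed (use zero e in \<open>simp_all del: of_nat_sum\<close>)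
  then have "int (\<Sum>j<N. \<Sum>i\<in>I. hilbert_fun (V i) (M i) j) \<le> int (e * s)" by simp
  then show ?thesis unfolding of_nat_le_iff M_def B_def .
qed

text \<open>If d \<le> e, the pure powers X_v^e and X_w^e both send F to constants, so a nontrivial
  combination of them annihilates F.\<close>

lemma perp_trivial_imp_less:
  fixes F :: "('v, 'k::field) mpoly"
  assumes v: "v \<in> V" "w \<in> V" "v \<noteq> w" and e: "e \<ge> 1" and F: "homog d F"
    and perp: "graded_part e (perp V F) = {0}"
  shows "e < d"
proof (rule ccontr)
  assume "\<not> e < d"
  define g where "g x = single (single x e) (1::'k)" for x :: 'v
  have g: "g x \<in> polyring V" "homog e (g x)" if "x \<in> V" for x
    using that by (auto simp: g_def polyring_single homog_single)
  have lg: "lookup (g x) (single y e) = (if x = y then 1 else 0)" for x y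
  proof -
    have "single x e = single y e \<longleftrightarrow> x = y" using e by (metis keys_single not_one_le_zero singleton_inject)
    then show ?thesis by (simp add: g_def lookup_single when_def)
  qed
  define c where "c x = lookup (apolar (g x) F) 0" for x
  have c: "apolar (g x) F = kscale (c x) 1" if "x \<in> V" for x
  proof (rule poly_mapping_eqI)
    fix \<alpha>
    have "homog 0 (apolar (g x) F)"
      using homog_apolar[OF g(2)[OF that] F] \<open>\<not> e < d\<close> by simp
    then show "lookup (apolar (g x) F) \<alpha> = lookup (kscale (c x) 1) \<alpha>"
      by (auto simp: c_def homog_def lookup_one when_def in_keys_iff)
  qed
  have in_perp: "h = 0" if "h \<in> polyring V" "homog e h" "apolar h F = 0" for h
    using perp that by (auto simp: graded_part_def perp_def)
  \<comment> \<open>This combination annihilates F whatever the constants are. Its vanishing forces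
    \<open>c w\<close> = 0, whereupon X_w^e alone annihilates F.\<close>
  have "kscale (c w) (g v) + kscale (- c v) (g w) = 0"
  proof (rule in_perp)
    show "apolar (kscale (c w) (g v) + kscale (- c v) (g w)) F = 0"
      unfolding apolar_add_left apolar_kscale c[OF v(1)] c[OF v(2)] by (simp add: mult.commute)
  qed (intro polyring_add homog_add polyring_kscale homog_kscale g v)+
  then have "lookup (kscale (c w) (g v) + kscale (- c v) (g w)) (single v e) = 0"
    by (simp only: lookup_zero)
  then have "c w = 0" using v(3) unfolding lookup_add lookup_kscale lg by simp
  then have "g w = 0" using in_perp[OF g] c v by simp
  then show False using lg[of w w] by simp
qed

text \<open>The decomposition is fixed before the t_i are chosen, since the t_i have to be general
  with respect to its points.\<close>

lemma sum_wrank_le: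
  fixes F :: "nat \<Rightarrow> ('v, 'k::field_char_0) mpoly"
  assumes ac: "alg_closed_type TYPE('k)" and I: "finite I" "I \<noteq> {}"
    and V: "\<And>i. i \<in> I \<Longrightarrow> finite (V i)" "\<And>i. i \<in> I \<Longrightarrow> \<exists>v\<in>V i. \<exists>w\<in>V i. v \<noteq> w"
    and disj: "\<And>i j. i \<in> I \<Longrightarrow> j \<in> I \<Longrightarrow> i \<noteq> j \<Longrightarrow> V i \<inter> V j = {}"
    and e: "1 \<le> e"
    and F: "\<And>i. i \<in> I \<Longrightarrow> F i \<in> polyring (V i)" "\<And>i. i \<in> I \<Longrightarrow> homog d (F i)"
    and comp: "\<And>i. i \<in> I \<Longrightarrow> e_computable (V i) d e (F i)"
    and perp: "\<And>i. i \<in> I \<Longrightarrow> graded_part e (perp (V i) (F i)) = {0}"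
    and s: "power_sum W d s (\<Sum>i\<in>I. F i)"
  shows "(\<Sum>i\<in>I. wrank (V i) d (F i)) \<le> s"
proof -
  have ed: "e < d"
  proof -
    obtain i where i: "i \<in> I" using I by blast
    then obtain v w where "v \<in> V i" "w \<in> V i" "v \<noteq> w" using V by blast
    then show ?thesis using perp_trivial_imp_less[OF _ _ _ e F(2)[OF i] perp[OF i]] by blast
  qed
  obtain L where L: "\<forall>l<s. linear_form W (L l)" "(\<Sum>i\<in>I. F i) = (\<Sum>l<s. L l ^ d)"
    using s unfolding power_sum_def by (elim exE conjE)
  have L1: "homog 1 (L l)" if "l < s" for l using L that by (simp add: linear_form_def)
  define pe where "pe l = poly_eval (point_of (L l))" for l
  define HF where "HF A i t j = hilbert_fun (V i) (ideal_plus_principal (V i)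
    (colon (V i) (perp (V i) (F i)) (ideal_gen (V i) A)) t) j" for A i t j
  define Q where "Q i A t \<longleftrightarrow> A \<subseteq> graded_part e (polyring (V i)) \<and>
      t \<in> graded_part e (ideal_gen (V i) A) \<and> t \<noteq> 0 \<and>
      (\<forall>l<s. (\<exists>h\<in>A. pe l h \<noteq> 0) \<longrightarrow> pe l t \<noteq> 0) \<and>
      summable (\<lambda>j. real (HF A i t j)) \<and>
      real e * real (wrank (V i) d (F i)) = suminf (\<lambda>j. real (HF A i t j))" for i A t
  have "\<exists>A t. Q i A t" if i: "i \<in> I" for i
  proof -
    obtain A U where A: "A \<subseteq> graded_part e (polyring (V i))"
      and U: "zariski_open_in (graded_part e (ideal_gen (V i) A)) U" "U \<noteq> {}"
      and HF: "\<forall>t\<in>U. summable (\<lambda>j. real (HF A i t j)) \<and>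
        real (wrank (V i) d (F i)) = (1 / real e) * suminf (\<lambda>j. real (HF A i t j))"
      using comp[OF i] unfolding e_computable_def Let_def HF_def by (elim exE conjE)
    have UI: "U \<subseteq> graded_part e (ideal_gen (V i) A)" using U by (auto simp: zariski_open_in_def)
    have Ae: "h \<in> polyring (V i)" "homog e h" if "h \<in> A" for h
      using A that by (auto simp: graded_part_def)
    \<comment> \<open>For the zero ideal the colon is the whole ring, so the Hilbert function and
      hence the rank are 0. Then F_i = 0 and all forms of degree e annihilate it, contrary to the
      hypothesis.\<close>
    have "\<exists>h\<in>A. h \<noteq> 0"
    proof (rule ccontr)
      assume "\<not> ?thesis"
      then have A0: "\<And>h. h \<in> A \<Longrightarrow> h = 0" by blast
      have I0: "h = 0" if h: "h \<in> ideal_gen (V i) A" for h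
      proof -
        obtain n and b a :: "nat \<Rightarrow> ('v, 'k) mpoly"
          where "\<forall>j<n. b j \<in> polyring (V i) \<and> a j \<in> A" "h = (\<Sum>j<n. b j * a j)"
          using h unfolding ideal_gen_def mem_Collect_eq by (elim exE conjE)
        moreover from this have "b j * a j = 0" if "j < n" for j using A0 that by force
        ultimately show ?thesis by simp
      qed
      have "0 \<in> perp (V i) (F i)" by (simp add: perp_def)
      then have "g * h \<in> perp (V i) (F i)" if "h \<in> ideal_gen (V i) A" for g h
        using I0[OF that] by simp
      then have "colon (V i) (perp (V i) (F i)) (ideal_gen (V i) A) = polyring (V i)"
        unfolding colon_def by blast
      moreover obtain t where t: "t \<in> U" using U(2) by blast
      moreover have "t = 0" using t UI by (intro I0) (auto simp: graded_part_def)
      moreover have "ideal_plus_principal (V i) (polyring (V i) :: ('v, 'k) mpoly set) 0 = polyring (V i)"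
        by (auto simp: ideal_plus_principal_def)
      ultimately have "HF A i t j = 0" for j by (simp add: HF_def hilbert_fun_def)
      then have "wrank (V i) d (F i) = 0" using bspec[OF HF t] by simp
      then have "power_sum (V i) d 0 (F i)"
        \<comment> \<open>Rank 0 yields F_i = 0 only because some decomposition exists, so that the
          least length is attained.\<close>
        using power_sum_wrank power_sum_exists[OF ac _ F(1)[OF i] F(2)[OF i]] ed by fastforce
      then have Fi: "F i = 0" by (simp add: power_sum_def)
      obtain v where "v \<in> V i" using V(2)[OF i] by blast
      then have "single (single v e) 1 \<in> graded_part e (perp (V i) (F i))"
        by (auto simp: graded_part_def perp_def Fi polyring_single homog_single)
      then show False using perp[OF i] by (simp add: single_eq_0_iff)
    qed
    then obtain h where h: "h \<in> A" "h \<noteq> 0" by blast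
    \<comment> \<open>Otherwise h would annihilate F and therefore F_i. A point where h is nonzero
      is one where the general t is nonzero, which shows t \<noteq> 0.\<close>
    have "\<exists>l<s. pe l h \<noteq> 0"
    proof (rule ccontr)
      assume "\<not> ?thesis"
      then have "apolar h (\<Sum>l<s. L l ^ d) = 0"
        by (intro apolar_power_sum_vanishing[OF Ae(2)[OF h(1)]] L1) (auto simp: pe_def)
      then have "apolar h (F i) = 0"
        using apolar_disjoint[where V = V and F = F, OF I(1) disj F(1) i Ae[OF h(1)] e] L(2) by simp
      then have "h \<in> graded_part e (perp (V i) (F i))" using Ae[OF h(1)] by (simp add: graded_part_def perp_def)
      then show False using perp[OF i] h by blast
    qed
    then obtain l where l: "l < s" "pe l h \<noteq> 0" by blast
    have "\<exists>t\<in>U. \<forall>l\<in>{l. l < s \<and> (\<exists>h\<in>A. pe l h \<noteq> 0)}. poly_eval (point_of (L l)) t \<noteq> 0"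
      using Ae ideal_gen_add_generator
      by (intro general_element[OF U, where A = A]) (auto simp: graded_part_def pe_def homog_add homog_kscale)
    then obtain t where t: "t \<in> U" "\<And>l. l < s \<Longrightarrow> \<exists>h\<in>A. pe l h \<noteq> 0 \<Longrightarrow> pe l t \<noteq> 0"
      by (auto simp: pe_def)
    have "pe l t \<noteq> 0" using t(2)[OF l(1)] l(2) h(1) by blast
    then have "t \<noteq> 0" by (auto simp: pe_def)
    moreover have "real e * real (wrank (V i) d (F i)) = suminf (\<lambda>j. real (HF A i t j))"
      using bspec[OF HF t(1)] e by simp
    ultimately have "Q i A t"
      unfolding Q_def using A t(2) subsetD[OF UI t(1)] bspec[OF HF t(1)] by (intro conjI) simp_all
    then show ?thesis by blast
  qed
  then obtain A t where Q: "\<And>i. i \<in> I \<Longrightarrow> Q i (A i) (t i)" by metis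
  have At: "A i \<subseteq> graded_part e (polyring (V i))" "t i \<in> graded_part e (ideal_gen (V i) (A i))" "t i \<noteq> 0"
    and general: "\<And>l. l < s \<Longrightarrow> \<exists>h\<in>A i. pe l h \<noteq> 0 \<Longrightarrow> pe l (t i) \<noteq> 0"
    and sm: "summable (\<lambda>j. real (HF (A i) i (t i) j))"
    and rk: "real e * real (wrank (V i) d (F i)) = suminf (\<lambda>j. real (HF (A i) i (t i) j))"
    if "i \<in> I" for i
    using Q[OF that] unfolding Q_def by (elim conjE, assumption | blast)+
  have le: "(\<Sum>j<N. \<Sum>i\<in>I. HF (A i) i (t i) j) \<le> e * s" for N
    unfolding HF_def
    by (rule hilbert_sum_le[where V = V and F = F and A = A and t = t and L = L and d = d, OF I(1) V(1) disj e ed F perp L1 L(2) At general[unfolded pe_def]])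
  have "real e * real (\<Sum>i\<in>I. wrank (V i) d (F i)) = (\<Sum>i\<in>I. suminf (\<lambda>j. real (HF (A i) i (t i) j)))"
    using rk by (simp add: sum_distrib_left)
  also have "\<dots> = suminf (\<lambda>j. \<Sum>i\<in>I. real (HF (A i) i (t i) j))"
    by (rule suminf_sum[symmetric]) (rule sm)
  also have "\<dots> \<le> real (e * s)"
  proof (rule suminf_le_const)
    show "summable (\<lambda>j. \<Sum>i\<in>I. real (HF (A i) i (t i) j))" by (rule summable_sum) (rule sm)
    fix N
    have "real (\<Sum>j<N. \<Sum>i\<in>I. HF (A i) i (t i) j) \<le> real (e * s)"
      using le[of N] by (rule of_nat_mono)
    then show "(\<Sum>j<N. \<Sum>i\<in>I. real (HF (A i) i (t i) j)) \<le> real (e * s)" by simp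
  qed
  finally have "real (e * (\<Sum>i\<in>I. wrank (V i) d (F i))) \<le> real (e * s)" by simp
  then have "e * (\<Sum>i\<in>I. wrank (V i) d (F i)) \<le> e * s" unfolding of_nat_le_iff .
  then show ?thesis using e by simp
qed

theorem theorem5p5:
  fixes m d e :: nat
    and n :: "nat \<Rightarrow> nat"
    and F :: "nat \<Rightarrow> (nat \<times> nat, 'k::field_char_0) mpoly"
  assumes alg_closed: "alg_closed_type TYPE('k)"
    and n_ge: "\<forall>i\<in>{1..m}. n i \<ge> 1"
    and e_ge: "e \<ge> 1"
    and F_form: "\<forall>i\<in>{1..m}. F i \<in> polyring ({i} \<times> {0..n i}) \<and> homog d (F i)"
    and F_comp: "\<forall>i\<in>{1..m}. e_computable ({i} \<times> {0..n i}) d e (F i)"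
    and F_perp: "\<forall>i\<in>{1..m}. graded_part e (perp ({i} \<times> {0..n i}) (F i)) = {0}"
  shows "wrank (\<Union>i\<in>{1..m}. {i} \<times> {0..n i}) d (\<Sum>i\<in>{1..m}. F i)
           = (\<Sum>i\<in>{1..m}. wrank ({i} \<times> {0..n i}) d (F i))"
proof (cases "m = 0")
  case True
  \<comment> \<open>The empty sum has the empty decomposition. This case is separate because e < d
    is read off from block 1.\<close>
  then show ?thesis using wrank_le[OF power_sum_0, of "{}" d] by simp
next
  case False
  define V where "V i = {i} \<times> {0..n i}" for i
  have two: "\<exists>v\<in>V i. \<exists>w\<in>V i. v \<noteq> w" if "i \<in> {1..m}" for i
    using n_ge that by (intro bexI[of _ "(i, 0)"] bexI[of _ "(i, 1)"]) (auto simp: V_def)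
  have "e < d"
  proof (rule perp_trivial_imp_less)
    show "(1, 0) \<in> V 1" "(1, 1) \<in> V 1" using n_ge False by (auto simp: V_def)
    show "homog d (F 1)" "graded_part e (perp (V 1) (F 1)) = {0}"
      using F_form F_perp False by (auto simp: V_def)
  qed (use e_ge in auto)
  then have "\<exists>r. power_sum (V i) d r (F i)" if "i \<in> {1..m}" for i
    using F_form that by (intro power_sum_exists[OF alg_closed]) (auto simp: V_def)
  then have "power_sum (\<Union>i\<in>{1..m}. V i) d (\<Sum>i\<in>{1..m}. wrank (V i) d (F i)) (\<Sum>i\<in>{1..m}. F i)"
    using power_sum_wrank by (intro power_sum_sum) blast+
  \<comment> \<open>Joining shortest decompositions of the F_i bounds the rank of F from above; the
    same existence provides a shortest decomposition of F, to which the lower bound is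
    applied.\<close>
  note upper = wrank_le[OF this] and least = power_sum_wrank[OF this]
  have "(\<Sum>i\<in>{1..m}. wrank (V i) d (F i)) \<le> wrank (\<Union>i\<in>{1..m}. V i) d (\<Sum>i\<in>{1..m}. F i)"
    by (rule sum_wrank_le[OF alg_closed _ _ _ two _ e_ge _ _ _ _ least])
      (use False F_form F_comp F_perp in \<open>auto simp: V_def\<close>)
  with upper show ?thesis by (simp add: V_def)
qed

end
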